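(* Given a link type $[L]$, let $$\mathcal{G}^{adj}([L])=\{G^{adj}(D,\sigma)\mid D\text{ is a diagram of a link of type }[L]\text{ and }\sigma\text{ is either of the two shadings of }D\},$$ $$\mathcal{G}^{adj}_s([L])=\{G^{adj}(D,\sigma_s)\mid D\text{ is a diagram of a link of type }[L]\},$$ $$\mathcal{G}^{adj}_u([L])=\{G^{adj}(D,\sigma_u)\mid D\text{ is a diagram of a link of type }[L]\}.$$ Then $\mathcal{G}^{adj}([L])=\mathcal{G}^{adj}_s([L])=\mathcal{G}^{adj}_u([L])$.
   Context: A (classical, unoriented) link is a finite union of pairwise disjoint, piecewise smooth simple closed curves in $\mathbb{R}^3$; a link type $[L]$ is a class of links under piecewise smooth, orientation-preserving autohomeomorphisms of $\mathbb{R}^3$. A link diagram $D$ is a projection of a link to a plane whose only singularities are finitely many transverse double points (crossings), together with over/under information at each crossing (crossing-free closed curves are allowed). The universe of $D$ is the image of the projection; the complementary regions are the connected components of its complement in the plane. A checkerboard shading $\sigma$ of $D$ labels each complementary region shaded or unshaded so that every edge of the universe has a shaded region on one side and an unshaded region on the other; there are exactly two. $\sigma_s$ denotes the shading in which the unbounded region is shaded, and $\sigma_u$ the shading in which it is unshaded. Given $\sigma$, the Goeritz index of a crossing $c$ is $\eta(c)=1$ if an observer standing in an unshaded region and facing the crossing sees the overpassing arc on the right, and $\eta(c)=-1$ if such an observer sees it on the left. Let $R_1,\dots,R_n$ be the unshaded regions according to $\sigma$, and let $C_{ij}$ be the set of crossings incident on $R_i$ and $R_j$. The Goeritz matrix $G(D,\sigma)$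 is the $n\times n$ integer matrix with $G(D,\sigma)_{ij}=-\sum_{c\in C_{ij}}\eta(c)$ for $i\ne j$ and $G(D,\sigma)_{ii}=-\sum_{k\neq i}G(D,\sigma)_{ik}$. The shaded checkerboard graph $\Gamma_s(D,\sigma)$ has a vertex for each shaded region and an edge for each crossing, incident on the vertex or vertices of the shaded region(s) at that crossing; $\beta_s(D,\sigma)$ is its number of connected components. The adjusted Goeritz matrix is $$G^{adj}(D,\sigma)=\begin{pmatrix}G(D,\sigma)&0\\0&B(D,\sigma)\end{pmatrix},$$ where $B(D,\sigma)$ is the $(\beta_s(D,\sigma)-1)\times(\beta_s(D,\sigma)-1)$ zero matrix. Rows and columns are regarded as unordered, so two such matrices are considered equal if they agree after a bijection of index sets (a simultaneous permutation of rows and columns). *)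

theory Defs
  imports "HOL-Analysis.Analysis" "Jordan_Normal_Form.Matrix"
begin

(* Both libraries use "$"; below it always means the component of a vector in real^3. *)
no_notation Matrix.vec_index (infixl \<open>$\<close> 100)

section \<open>Smooth and piecewise smooth maps\<close>

text \<open>\<open>higher_differentiable_on U f k\<close> says that \<open>f\<close> is of class $C^k$ on the open set \<open>U\<close>:
  iterated directional derivatives are taken along arbitrary vectors.\<close>

primrec higher_differentiable_on ::
  "'a::euclidean_space set \<Rightarrow> ('a \<Rightarrow> 'b::euclidean_space) \<Rightarrow> nat \<Rightarrow> bool" where
  "higher_differentiable_on U f 0 \<longleftrightarrow> continuous_on U f"
| "higher_differentiable_on U f (Suc k) \<longleftrightarrow>
     (\<forall>x\<in>U. f differentiable (at x)) \<and>
     (\<forall>v. higher_differentiable_on U (\<lambda>x. frechet_derivative f (at x) v) k)"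

definition smooth_on :: "'a::euclidean_space set \<Rightarrow> ('a \<Rightarrow> 'b::euclidean_space) \<Rightarrow> bool" where
  "smooth_on U f \<longleftrightarrow> (\<forall>k. higher_differentiable_on U f k)"

text \<open>A map on a set that need not be open is smooth if it is the restriction of a smooth map on an
  open neighbourhood. The derivative is moreover required to be injective: without
  this, an arc with a smooth parametrization could have corners, or even be wild.\<close>

definition smooth_immersion_on :: "'a::euclidean_space set \<Rightarrow> ('a \<Rightarrow> 'b::euclidean_space) \<Rightarrow> bool" where
  "smooth_immersion_on S f \<longleftrightarrow>
     (\<exists>U g. open U \<and> S \<subseteq> U \<and> smooth_on U g \<and>
        (\<forall>x\<in>S. g x = f x \<and> inj (frechet_derivative g (at x))))"

definition piecewise_smooth_curve :: "(real \<Rightarrow> 'a::euclidean_space) \<Rightarrow> bool" where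
  "piecewise_smooth_curve \<gamma> \<longleftrightarrow>
     path \<gamma> \<and>
     (\<exists>T. finite T \<and> {0, 1} \<subseteq> T \<and> T \<subseteq> {0..1} \<and>
        (\<forall>a\<in>T. \<forall>b\<in>T. a < b \<and> {a<..<b} \<inter> T = {} \<longrightarrow> smooth_immersion_on {a..b} \<gamma>))"

definition piecewise_smooth_homeomorphism :: "(real^3 \<Rightarrow> real^3) \<Rightarrow> bool" where
  "piecewise_smooth_homeomorphism f \<longleftrightarrow>
     (\<exists>g. homeomorphism UNIV UNIV f g) \<and>
     (\<exists>\<P>. locally_finite_in euclidean \<P> \<and> \<Union>\<P> = UNIV \<and>
        (\<forall>P\<in>\<P>. polyhedron P \<and> smooth_immersion_on P f))"

text \<open>This is used for piecewise smooth homeomorphisms only. Such a map is differentiable, with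
  nonzero Jacobian determinant, away from the boundaries of the pieces.\<close>

definition orientation_preserving :: "(real^3 \<Rightarrow> real^3) \<Rightarrow> bool" where
  "orientation_preserving f \<longleftrightarrow>
     (\<forall>x f'. (f has_derivative f') (at x) \<longrightarrow> 0 < Determinants.det (matrix f'))"

section \<open>Links and link types\<close>

text \<open>Links have at least one component.\<close>

definition parametrizes_link :: "(real \<Rightarrow> real^3) set \<Rightarrow> (real^3) set \<Rightarrow> bool" where
  "parametrizes_link \<Gamma> K \<longleftrightarrow>
     finite \<Gamma> \<and> \<Gamma> \<noteq> {} \<and>
     (\<forall>\<gamma>\<in>\<Gamma>. simple_path \<gamma> \<and> pathfinish \<gamma> = pathstart \<gamma> \<and> piecewise_smooth_curve \<gamma>) \<and>
     pairwise (\<lambda>\<gamma> \<delta>. path_image \<gamma> \<inter> path_image \<delta> = {}) \<Gamma> \<and>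
     K = (\<Union>\<gamma>\<in>\<Gamma>. path_image \<gamma>)"

definition is_link :: "(real^3) set \<Rightarrow> bool" where
  "is_link K \<longleftrightarrow> (\<exists>\<Gamma>. parametrizes_link \<Gamma> K)"

definition link_homeomorphic :: "(real^3) set \<Rightarrow> (real^3) set \<Rightarrow> bool" where
  "link_homeomorphic K K' \<longleftrightarrow>
     is_link K \<and> is_link K' \<and>
     (\<exists>f. piecewise_smooth_homeomorphism f \<and> orientation_preserving f \<and> f ` K = K')"

text \<open>Piecewise smooth maps with polyhedral pieces are not closed under composition, hence the
  generated equivalence relation.\<close>

definition link_type :: "(real^3) set \<Rightarrow> (real^3) set set" where
  "link_type L = {K. is_link K \<and> equivclp link_homeomorphic L K}"

section \<open>Link diagrams\<close>

text \<open>The plane of projection is \<open>complex\<close>, seen from above: greater third coordinate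
  means closer to the viewer.\<close>

definition proj :: "real^3 \<Rightarrow> complex" where
  "proj x = Complex (x $ 1) (x $ 2)"

text \<open>Nonzero velocities at \<open>x\<close> of curves in \<open>K\<close> that pass through \<open>x\<close>. At a corner or cusp of a
  piecewise smooth simple closed curve there are none; at every other point they form the tangent
  line without 0.\<close>

definition tangent_vectors :: "(real^3) set \<Rightarrow> real^3 \<Rightarrow> (real^3) set" where
  "tangent_vectors K x =
     {v. v \<noteq> 0 \<and> (\<exists>g. g 0 = x \<and> range g \<subseteq> K \<and> (g has_vector_derivative v) (at 0))}"

text \<open>Over/under information: \<open>over_tangents D c\<close> and \<open>under_tangents D c\<close> are the nonzero tangent
  vectors at the crossing \<open>c\<close> of the overpassing and of the underpassing arc.\<close>

record link_diagram =
  universe :: "complex set"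
  crossings :: "complex set"
  over_tangents :: "complex \<Rightarrow> complex set"
  under_tangents :: "complex \<Rightarrow> complex set"

definition diagram_of :: "(real^3) set \<Rightarrow> link_diagram" where
  "diagram_of K =
     \<lparr> universe = proj ` K,
       crossings = {c. \<exists>x\<in>K. \<exists>y\<in>K. x \<noteq> y \<and> proj x = c \<and> proj y = c},
       over_tangents = (\<lambda>c. {proj v | v x y. x \<in> K \<and> y \<in> K \<and> proj x = c \<and> proj y = c \<and>
                               y $ 3 < x $ 3 \<and> v \<in> tangent_vectors K x}),
       under_tangents = (\<lambda>c. {proj v | v x y. x \<in> K \<and> y \<in> K \<and> proj x = c \<and> proj y = c \<and>
                               x $ 3 < y $ 3 \<and> v \<in> tangent_vectors K x}) \<rparr>"

text \<open>The only singularities of the projection are finitely many transverse double points;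
  \<open>Im (cnj u * v)\<close> is the determinant of the pair of plane vectors \<open>u\<close>, \<open>v\<close>.\<close>

definition regular_projection :: "(real^3) set \<Rightarrow> bool" where
  "regular_projection K \<longleftrightarrow>
     (\<exists>\<Gamma>. parametrizes_link \<Gamma> K \<and> (\<forall>\<gamma>\<in>\<Gamma>. piecewise_smooth_curve (proj \<circ> \<gamma>))) \<and>
     finite (crossings (diagram_of K)) \<and>
     (\<forall>c\<in>crossings (diagram_of K).
        card {x\<in>K. proj x = c} = 2 \<and>
        (\<exists>u\<in>over_tangents (diagram_of K) c. \<exists>v\<in>under_tangents (diagram_of K) c.
           Im (cnj u * v) \<noteq> 0))"

text \<open>The rotation carries the plane onto which \<open>K\<close> is projected to the standard plane.\<close>

definition is_diagram :: "link_diagram \<Rightarrow> (real^3) set \<Rightarrow> bool" where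
  "is_diagram D K \<longleftrightarrow>
     (\<exists>Q :: real^3^3. rotation_matrix Q \<and> regular_projection ((*v) Q ` K) \<and>
        D = diagram_of ((*v) Q ` K))"

definition regions :: "link_diagram \<Rightarrow> complex set set" where
  "regions D = components (- universe D)"

text \<open>Crossing-free closed curves count as edges.\<close>

definition edges :: "link_diagram \<Rightarrow> complex set set" where
  "edges D = components (universe D - crossings D)"

section \<open>Checkerboard shadings\<close>

text \<open>A shading is given by its set of shaded regions. The regions whose frontier contains an edge
  are exactly those on its two sides.\<close>

definition is_shading :: "link_diagram \<Rightarrow> complex set set \<Rightarrow> bool" where
  "is_shading D \<sigma> \<longleftrightarrow>
     \<sigma> \<subseteq> regions D \<and>
     (\<forall>e\<in>edges D. (\<exists>R\<in>\<sigma>. e \<subseteq> frontier R) \<and> (\<exists>R\<in>regions D - \<sigma>. e \<subseteq> frontier R))"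

definition is_sigma_s :: "link_diagram \<Rightarrow> complex set set \<Rightarrow> bool" where
  "is_sigma_s D \<sigma> \<longleftrightarrow> is_shading D \<sigma> \<and> (\<exists>R\<in>\<sigma>. \<not> bounded R)"

definition is_sigma_u :: "link_diagram \<Rightarrow> complex set set \<Rightarrow> bool" where
  "is_sigma_u D \<sigma> \<longleftrightarrow> is_shading D \<sigma> \<and> (\<exists>R\<in>regions D - \<sigma>. \<not> bounded R)"

section \<open>Goeritz matrices\<close>

definition approach_directions :: "complex set \<Rightarrow> complex \<Rightarrow> complex set" where
  "approach_directions R c =
     {d. \<exists>g. g 0 = c \<and> (\<forall>t>0. g t \<in> R) \<and> (g has_vector_derivative d) (at 0 within {0..})}"

text \<open>Someone looking in direction \<open>f\<close> has direction \<open>- \<i> * f\<close> to the right.\<close>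

definition to_the_right :: "complex \<Rightarrow> complex \<Rightarrow> bool" where
  "to_the_right f w \<longleftrightarrow> 0 < w \<bullet> (- \<i> * f)"

text \<open>The two arcs divide a neighbourhood of the crossing \<open>c\<close> into four sectors. The one bounded by
  the half-arcs leaving \<open>c\<close> in the directions \<open>u\<close> (over) and \<open>v\<close> (under) contains the direction
  \<open>u + v\<close>. An observer there faces \<open>c\<close> in the direction \<open>- (u + v)\<close>.\<close>

definition goeritz_index :: "link_diagram \<Rightarrow> complex set set \<Rightarrow> complex \<Rightarrow> int" where
  "goeritz_index D \<sigma> c =
     (if \<exists>R\<in>regions D - \<sigma>. \<exists>u\<in>over_tangents D c. \<exists>v\<in>under_tangents D c.
           u + v \<in> approach_directions R c \<and> to_the_right (- (u + v)) u
      then 1 else - 1)"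

definition incident_crossings :: "link_diagram \<Rightarrow> complex set \<Rightarrow> complex set \<Rightarrow> complex set" where
  "incident_crossings D R S = {c\<in>crossings D. c \<in> frontier R \<and> c \<in> frontier S}"

text \<open>The list \<open>Rs\<close> enumerates the unshaded regions.\<close>

definition goeritz_matrix :: "link_diagram \<Rightarrow> complex set set \<Rightarrow> complex set list \<Rightarrow> int mat" where
  "goeritz_matrix D \<sigma> Rs =
     (let n = length Rs;
          g = (\<lambda>i j. - (\<Sum>c\<in>incident_crossings D (Rs ! i) (Rs ! j). goeritz_index D \<sigma> c))
      in Matrix.mat n n (\<lambda>(i, j). if i = j then - (\<Sum>k\<in>{..<n} - {i}. g i k) else g i j))"

text \<open>Vertices joined by an edge of the shaded checkerboard graph. The pairs \<open>(R, R)\<close> that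
  also occur do not affect connected components.\<close>

definition shaded_adjacency :: "link_diagram \<Rightarrow> complex set set \<Rightarrow> complex set rel" where
  "shaded_adjacency D \<sigma> =
     {(R, S). R \<in> \<sigma> \<and> S \<in> \<sigma> \<and> (\<exists>c\<in>crossings D. c \<in> frontier R \<and> c \<in> frontier S)}"

definition beta_s :: "link_diagram \<Rightarrow> complex set set \<Rightarrow> nat" where
  "beta_s D \<sigma> = card (\<sigma> // ((shaded_adjacency D \<sigma>)\<^sup>* \<inter> \<sigma> \<times> \<sigma>))"

definition adjusted_goeritz_matrix ::
  "link_diagram \<Rightarrow> complex set set \<Rightarrow> complex set list \<Rightarrow> int mat" where
  "adjusted_goeritz_matrix D \<sigma> Rs =
     (let n = length Rs; b = beta_s D \<sigma> - 1
      in four_block_mat (goeritz_matrix D \<sigma> Rs) (0\<^sub>m n b) (0\<^sub>m b n) (0\<^sub>m b b))"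

definition permutation_equivalent :: "'a mat \<Rightarrow> 'a mat \<Rightarrow> bool" where
  "permutation_equivalent A B \<longleftrightarrow>
     (\<exists>n p. A \<in> carrier_mat n n \<and> p permutes {..<n} \<and>
        B = Matrix.mat n n (\<lambda>(i, j). A $$ (p i, p j)))"

text \<open>A square matrix with unordered rows and columns is represented by the class of all its
  orderings.\<close>

definition adjusted_goeritz :: "link_diagram \<Rightarrow> complex set set \<Rightarrow> int mat set" where
  "adjusted_goeritz D \<sigma> =
     {B. \<exists>Rs. distinct Rs \<and> set Rs = regions D - \<sigma> \<and>
           permutation_equivalent (adjusted_goeritz_matrix D \<sigma> Rs) B}"

definition adj_goeritz_set :: "(real^3) set set \<Rightarrow> int mat set set" where
  "adj_goeritz_set \<L> = {adjusted_goeritz D \<sigma> | D \<sigma> K. K \<in> \<L> \<and> is_diagram D K \<and> is_shading D \<sigma>}"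

definition adj_goeritz_set_s :: "(real^3) set set \<Rightarrow> int mat set set" where
  "adj_goeritz_set_s \<L> = {adjusted_goeritz D \<sigma> | D \<sigma> K. K \<in> \<L> \<and> is_diagram D K \<and> is_sigma_s D \<sigma>}"

definition adj_goeritz_set_u :: "(real^3) set set \<Rightarrow> int mat set set" where
  "adj_goeritz_set_u \<L> = {adjusted_goeritz D \<sigma> | D \<sigma> K. K \<in> \<L> \<and> is_diagram D K \<and> is_sigma_u D \<sigma>}"

end

theory Submission
  imports Defs
begin

text \<open>Move a point of a region of the other shade to infinity: for \<open>p\<close> in that region, the map
  $z \mapsto 1/(z-p)$ of the plane is conformal and orientation-preserving, so, applied to a
  diagram with the heights kept, it yields a diagram with the same Goeritz data whose unbounded
  region comes from the region of \<open>p\<close>. The link type does not change: in coordinates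
  $(\theta, s, h)$ with $s = \ln |z - p|$, the map of space is
  $(\theta, s, h) \mapsto (-\theta, -s, h)$, that is, the half turn
  $(\theta, s, h) \mapsto (-\theta, s, -h)$ of space after the half turn
  $(s, h) \mapsto (-s, -h)$ of the half-planes bounded by the axis. Near the link, the latter
  agrees with a rotation by an angle depending on $s^2+h^2$ that vanishes far out, and this
  is the identity near the axis, so that it extends to a diffeomorphism of space.\<close>

text \<open>Crossings, their incidences with regions and their Goeritz indices make sense for
  diagrams on the sphere; only the choice of the point at infinity singles out an unbounded region.
  Link types, however, are taken in \<open>real^3\<close>, where no arc can be swept through
  infinity, and the lift of \<open>inverse (z - p)\<close> is singular along the whole vertical line
  over \<open>p\<close>. The way out is that a link is compact and misses that line, since
  \<open>p\<close> lies off its projection, so the map of space has to be right only on the link.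
  The logarithm turns inversion of the radius into a sign change of \<open>s\<close>. On its own
  this reverses the orientation of the \<open>(s, h)\<close>-plane and is no rotation; changing the
  sign of \<open>h\<close> as well gives the rotation by \<open>pi\<close>, whose angle can be cut
  off smoothly along circles about the origin of that plane. The two shadings of one diagram are
  never compared: a shading is carried along while infinity moves, so all that is required of it is
  a region of the desired shade. Such a region exists because every diagram has an edge.\<close>

no_notation Matrix.scalar_prod (infix \<open>\<bullet>\<close> 70)

section \<open>Closure properties of smooth maps\<close>

lemma higher_differentiable_on_subset:
  "higher_differentiable_on U f k \<Longrightarrow> V \<subseteq> U \<Longrightarrow> higher_differentiable_on V f k"
  by (induction k arbitrary: f) (auto intro: continuous_on_subset)

lemma higher_differentiable_on_cong:
  assumes "open U" "\<And>x. x \<in> U \<Longrightarrow> f x = g x"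
  shows "higher_differentiable_on U f k \<longleftrightarrow> higher_differentiable_on U g k"
  using assms(2)
proof (induction k arbitrary: f g)
  case 0
  then show ?case by (simp cong: continuous_on_cong)
next
  case (Suc k)
  have 1: "f differentiable (at x) \<longleftrightarrow> g differentiable (at x)" if "x \<in> U" for x
    unfolding differentiable_def
    using has_derivative_transform_within_open[OF _ assms(1) that] Suc.prems by metis
  have "frechet_derivative f (at x) = frechet_derivative g (at x)" if "x \<in> U" for x
  proof (cases "f differentiable (at x)")
    case True
    then show ?thesis
      using frechet_derivative_transform_within_open[OF _ assms(1) that] Suc.prems by blast
  next
    case False
    \<comment> \<open>Where no derivative exists, \<open>frechet_derivative\<close> is a choice from
      an empty predicate. The predicate is the same for \<open>f\<close> and \<open>g\<close>, hence
      so is the default value.\<close>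
    then have "\<And>D. \<not> (f has_derivative D) (at x)" "\<And>D. \<not> (g has_derivative D) (at x)"
      using 1[OF that] by (auto simp: differentiable_def)
    then show ?thesis by (simp add: frechet_derivative_def)
  qed
  then have "higher_differentiable_on U (\<lambda>x. frechet_derivative f (at x) v) k \<longleftrightarrow>
      higher_differentiable_on U (\<lambda>x. frechet_derivative g (at x) v) k" for v
    by (intro Suc.IH) simp
  with 1 show ?case by simp
qed

text \<open>By uniqueness of derivatives, any explicit formula \<open>F\<close> may replace the
  chosen \<open>frechet_derivative\<close> of the recursive definition.\<close>

lemma higher_differentiable_on_SucI:
  assumes "open U" "\<And>x. x \<in> U \<Longrightarrow> (f has_derivative F x) (at x)"
    and "\<And>v. higher_differentiable_on U (\<lambda>x. F x v) k"
  shows "higher_differentiable_on U f (Suc k)"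
proof -
  have eq: "frechet_derivative f (at x) = F x" if "x \<in> U" for x
    using assms(2)[OF that] by (metis frechet_derivative_at)
  have "higher_differentiable_on U (\<lambda>x. frechet_derivative f (at x) v) k" for v
    using assms(3)[of v] higher_differentiable_on_cong[OF assms(1),
        where f="\<lambda>x. frechet_derivative f (at x) v" and g="\<lambda>x. F x v"]
    by (simp add: eq)
  with assms(2) show ?thesis
    by (auto simp: differentiable_def)
qed

text \<open>The recursive clause does not mention lower orders; at the bottom they are recovered as
  continuity of a differentiable map.\<close>

lemma higher_differentiable_on_SucD:
  "higher_differentiable_on U f (Suc k) \<Longrightarrow> higher_differentiable_on U f k"
proof (induction k arbitrary: f)
  case 0
  then show ?case
    by (auto intro!: continuous_at_imp_continuous_on differentiable_imp_continuous_within)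
next
  case (Suc k)
  then show ?case by (metis higher_differentiable_on.simps(2))
qed

lemma higher_differentiable_on_has_derivative:
  "higher_differentiable_on U f (Suc k) \<Longrightarrow> x \<in> U \<Longrightarrow>
    (f has_derivative frechet_derivative f (at x)) (at x)"
  by (simp add: frechet_derivative_works)

lemma higher_differentiable_on_const: "open U \<Longrightarrow> higher_differentiable_on U (\<lambda>x. c) k"
proof (induction k arbitrary: c)
  case (Suc k)
  show ?case
    by (rule higher_differentiable_on_SucI[where F="\<lambda>_ _. 0"]) (use Suc in auto)
qed auto

lemma higher_differentiable_on_add:
  assumes "open U" "higher_differentiable_on U f k" "higher_differentiable_on U g k"
  shows "higher_differentiable_on U (\<lambda>x. f x + g x) k"
  using assms(2,3)
proof (induction k arbitrary: f g)
  case (Suc k)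
  show ?case
    by (rule higher_differentiable_on_SucI
        [where F="\<lambda>x v. frechet_derivative f (at x) v + frechet_derivative g (at x) v"])
      (use Suc assms(1) in \<open>auto intro!: has_derivative_add simp: frechet_derivative_works\<close>)
qed (auto intro: continuous_intros)

lemma higher_differentiable_on_bounded_linear:
  assumes "open U" "bounded_linear L" "higher_differentiable_on U f k"
  shows "higher_differentiable_on U (\<lambda>x. L (f x)) k"
  using assms(3)
proof (induction k arbitrary: f)
  case 0
  then show ?case using bounded_linear.continuous_on[OF assms(2)] by auto
next
  case (Suc k)
  show ?case
    by (rule higher_differentiable_on_SucI[where F="\<lambda>x v. L (frechet_derivative f (at x) v)"])
      (use Suc assms(1) in
        \<open>auto intro!: bounded_linear.has_derivative[OF assms(2)] simp: frechet_derivative_works\<close>)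
qed

lemma higher_differentiable_on_bounded_bilinear:
  assumes "open U" "bounded_bilinear pr"
    and "higher_differentiable_on U f k" "higher_differentiable_on U g k"
  shows "higher_differentiable_on U (\<lambda>x. pr (f x) (g x)) k"
  using assms(3,4)
proof (induction k arbitrary: f g)
  case 0
  then show ?case using bounded_bilinear.continuous_on[OF assms(2)] by auto
next
  case (Suc k)
  show ?case
  proof (rule higher_differentiable_on_SucI[where F="\<lambda>x v. pr (f x) (frechet_derivative g (at x) v)
            + pr (frechet_derivative f (at x) v) (g x)"])
    show "((\<lambda>x. pr (f x) (g x)) has_derivative (\<lambda>v. pr (f x) (frechet_derivative g (at x) v)
            + pr (frechet_derivative f (at x) v) (g x))) (at x)" if "x \<in> U" for x
      using that Suc.prems
      by (intro bounded_bilinear.FDERIV[OF assms(2)] higher_differentiable_on_has_derivative)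
    show "higher_differentiable_on U (\<lambda>x. pr (f x) (frechet_derivative g (at x) v)
            + pr (frechet_derivative f (at x) v) (g x)) k" for v
      using Suc.prems Suc.prems[THEN higher_differentiable_on_SucD]
      by (intro higher_differentiable_on_add[OF assms(1)] Suc.IH) simp_all
  qed (fact assms(1))
qed

lemma higher_differentiable_on_sum:
  assumes "open U" "\<And>i. i \<in> I \<Longrightarrow> higher_differentiable_on U (f i) k"
  shows "higher_differentiable_on U (\<lambda>x. \<Sum>i\<in>I. f i x) k"
  using assms(2)
  by (induction I rule: infinite_finite_induct)
    (auto intro!: higher_differentiable_on_const higher_differentiable_on_add assms(1))

lemma higher_differentiable_on_compose:
  fixes f :: "'a::euclidean_space \<Rightarrow> 'b::euclidean_space" and g :: "'b \<Rightarrow> 'c::euclidean_space"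
  assumes "open U" "open V" "f ` U \<subseteq> V"
    and "higher_differentiable_on U f k" "higher_differentiable_on V g k"
  shows "higher_differentiable_on U (\<lambda>x. g (f x)) k"
  using assms(4,5)
proof (induction k arbitrary: g)
  case 0
  then show ?case
    using assms(3) by (auto intro: continuous_on_compose2)
next
  case (Suc k)
  \<comment> \<open>The chain rule differentiates \<open>g\<close> along
    \<open>frechet_derivative f (at x) v\<close>, a direction that varies with \<open>x\<close>,
    whereas the induction hypothesis covers fixed directions only. Expanding in the basis leaves
    fixed directions \<open>b\<close> with scalar coefficients.\<close>
  let ?F = "\<lambda>x v. \<Sum>b\<in>Basis. (frechet_derivative f (at x) v \<bullet> b) *\<^sub>R frechet_derivative g (at (f x)) b"
  show ?case
  proof (rule higher_differentiable_on_SucI[where F="?F"])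
    fix x assume x: "x \<in> U"
    with assms(3) have "f x \<in> V" by auto
    then have g: "(g has_derivative frechet_derivative g (at (f x))) (at (f x))"
      and f: "(f has_derivative frechet_derivative f (at x)) (at x)"
      using Suc.prems x by (auto simp: frechet_derivative_works)
    have rep: "frechet_derivative g (at (f x)) w = (\<Sum>b\<in>Basis. (w \<bullet> b) *\<^sub>R frechet_derivative g (at (f x)) b)" for w
    proof -
      have lin: "linear (frechet_derivative g (at (f x)))"
        using g by (simp add: has_derivative_linear)
      have "frechet_derivative g (at (f x)) w
          = frechet_derivative g (at (f x)) (\<Sum>b\<in>Basis. (w \<bullet> b) *\<^sub>R b)"
        by (simp add: euclidean_representation)
      then show ?thesis
        by (simp add: linear_sum[OF lin] linear_scale[OF lin])
    qed
    then have "?F x = (\<lambda>v. frechet_derivative g (at (f x)) (frechet_derivative f (at x) v))"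
      by (intro ext rep[symmetric])
    then show "((\<lambda>x. g (f x)) has_derivative ?F x) (at x)"
      using has_derivative_compose[OF f g] by simp
  next
    fix v
    show "higher_differentiable_on U (\<lambda>x. ?F x v) k"
    proof (intro higher_differentiable_on_sum[OF assms(1)]
          higher_differentiable_on_bounded_bilinear[OF assms(1) bounded_bilinear_scaleR])
      fix b :: 'b
      show "higher_differentiable_on U (\<lambda>x. frechet_derivative f (at x) v \<bullet> b) k"
        using Suc.prems(1)
        by (intro higher_differentiable_on_bounded_linear[OF assms(1) bounded_linear_inner_left]) simp
      show "higher_differentiable_on U (\<lambda>x. frechet_derivative g (at (f x)) b) k"
        using Suc.prems(2) by (intro Suc.IH higher_differentiable_on_SucD[OF Suc.prems(1)]) simp
    qed
  qed (fact assms(1))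
qed

text \<open>Derivatives are taken with respect to full neighbourhoods, so only continuity has to be
  glued.\<close>

lemma higher_differentiable_on_Un:
  assumes "open U" "open V" "higher_differentiable_on U f k" "higher_differentiable_on V f k"
  shows "higher_differentiable_on (U \<union> V) f k"
  using assms(3,4)
proof (induction k arbitrary: f)
  case 0
  then show ?case by (simp add: continuous_on_open_Un assms(1,2))
next
  case (Suc k)
  then show ?case unfolding higher_differentiable_on.simps by blast
qed

section \<open>Maps smooth of all orders\<close>

lemma smooth_on_subset: "smooth_on U f \<Longrightarrow> V \<subseteq> U \<Longrightarrow> smooth_on V f"
  unfolding smooth_on_def using higher_differentiable_on_subset by blast

lemma smooth_on_cong:
  "open U \<Longrightarrow> (\<And>x. x \<in> U \<Longrightarrow> f x = g x) \<Longrightarrow> smooth_on U f \<longleftrightarrow> smooth_on U g"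
  unfolding smooth_on_def using higher_differentiable_on_cong by metis

lemma smooth_on_compose:
  fixes f :: "'a::euclidean_space \<Rightarrow> 'b::euclidean_space" and g :: "'b \<Rightarrow> 'c::euclidean_space"
  assumes "smooth_on V g" "smooth_on U f" "open U" "open V" "f ` U \<subseteq> V"
  shows "smooth_on U (\<lambda>x. g (f x))"
  using assms higher_differentiable_on_compose unfolding smooth_on_def by blast

lemma smooth_on_Un:
  "open U \<Longrightarrow> open V \<Longrightarrow> smooth_on U f \<Longrightarrow> smooth_on V f \<Longrightarrow> smooth_on (U \<union> V) f"
  unfolding smooth_on_def using higher_differentiable_on_Un by blast

lemma smooth_on_has_derivative:
  "smooth_on U f \<Longrightarrow> x \<in> U \<Longrightarrow> (f has_derivative frechet_derivative f (at x)) (at x)"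
  unfolding smooth_on_def using higher_differentiable_on_has_derivative by blast

lemma smooth_on_continuous_on: "smooth_on U f \<Longrightarrow> continuous_on U f"
  unfolding smooth_on_def using higher_differentiable_on.simps(1) by blast

lemma smooth_on_frechet_derivative:
  "smooth_on U f \<Longrightarrow> smooth_on U (\<lambda>x. frechet_derivative f (at x) v)"
  unfolding smooth_on_def using higher_differentiable_on.simps(2) by blast

lemma smooth_on_const: "open U \<Longrightarrow> smooth_on U (\<lambda>x. c)"
  unfolding smooth_on_def using higher_differentiable_on_const by blast

lemma smooth_on_bounded_linear:
  assumes "open U" "bounded_linear L" "smooth_on U f"
  shows "smooth_on U (\<lambda>x. L (f x))"
  using assms higher_differentiable_on_bounded_linear unfolding smooth_on_def by blast

lemma smooth_on_ident:
  fixes U :: "'a::euclidean_space set"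
  assumes "open U"
  shows "smooth_on U (\<lambda>x. x)"
  unfolding smooth_on_def
proof
  fix k
  show "higher_differentiable_on U (\<lambda>x. x) k"
  proof (cases k)
    case (Suc j)
    show ?thesis
      unfolding Suc by (rule higher_differentiable_on_SucI[where F="\<lambda>_ v. v"])
        (use assms higher_differentiable_on_const in auto)
  qed auto
qed

lemma smooth_on_linear:
  assumes "open U" "bounded_linear L"
  shows "smooth_on U L"
  using smooth_on_bounded_linear[OF assms smooth_on_ident[OF assms(1)]] by simp

lemma smooth_on_add:
  "open U \<Longrightarrow> smooth_on U f \<Longrightarrow> smooth_on U g \<Longrightarrow> smooth_on U (\<lambda>x. f x + g x)"
  unfolding smooth_on_def using higher_differentiable_on_add by blast

lemma smooth_on_minus: "open U \<Longrightarrow> smooth_on U f \<Longrightarrow> smooth_on U (\<lambda>x. - f x)"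
  using smooth_on_bounded_linear[of U uminus] bounded_linear_minus[OF bounded_linear_ident] by auto

lemma smooth_on_diff:
  assumes "open U" "smooth_on U f" "smooth_on U g"
  shows "smooth_on U (\<lambda>x. f x - g x)"
  using smooth_on_add[OF assms(1,2) smooth_on_minus[OF assms(1,3)]] by simp

lemma smooth_on_mult:
  fixes f g :: "'a::euclidean_space \<Rightarrow> 'b::{euclidean_space, real_normed_algebra}"
  assumes "open U" "smooth_on U f" "smooth_on U g"
  shows "smooth_on U (\<lambda>x. f x * g x)"
  using assms higher_differentiable_on_bounded_bilinear[OF _ bounded_bilinear_mult]
  unfolding smooth_on_def by blast

lemma smooth_on_scaleR:
  assumes "open U" "smooth_on U f" "smooth_on U g"
  shows "smooth_on U (\<lambda>x. f x *\<^sub>R g x)"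
  using assms higher_differentiable_on_bounded_bilinear[OF _ bounded_bilinear_scaleR]
  unfolding smooth_on_def by blast

text \<open>The derivative of \<open>inverse\<close> is again a product of values of
  \<open>inverse\<close>, which closes the induction on the order.\<close>

lemma smooth_on_inverse:
  fixes U :: "'a::{euclidean_space, real_normed_field} set"
  assumes "open U" "0 \<notin> U"
  shows "smooth_on U (inverse :: 'a \<Rightarrow> 'a)"
  unfolding smooth_on_def
proof
  fix k
  show "higher_differentiable_on U (inverse :: 'a \<Rightarrow> 'a) k"
  proof (induction k)
    case 0
    show ?case using assms by (auto intro!: continuous_intros)
  next
    case (Suc k)
    show ?case
    proof (rule higher_differentiable_on_SucI[where F="\<lambda>x v. - (inverse x * v * inverse x)"])
      fix x assume "x \<in> U"
      then show "(inverse has_derivative (\<lambda>v. - (inverse x * v * inverse x))) (at x)"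
        using assms by (intro has_derivative_inverse') auto
    next
      fix v
      show "higher_differentiable_on U (\<lambda>x. - (inverse x * v * inverse x)) k"
        by (intro higher_differentiable_on_bounded_linear[OF assms(1)
              bounded_linear_minus[OF bounded_linear_ident]]
            higher_differentiable_on_bounded_bilinear[OF assms(1) bounded_bilinear_mult]
            higher_differentiable_on_const assms(1) Suc)
    qed (fact assms(1))
  qed
qed

section \<open>Elementary functions of one real variable\<close>

lemma higher_differentiable_on_SucI_real:
  fixes f :: "real \<Rightarrow> real"
  assumes "open U" "\<And>x. x \<in> U \<Longrightarrow> (f has_real_derivative f' x) (at x)"
    and "higher_differentiable_on U f' k"
  shows "higher_differentiable_on U f (Suc k)"
proof (rule higher_differentiable_on_SucI[where F="\<lambda>x v. f' x * v"])
  show "(f has_derivative (\<lambda>v. f' x * v)) (at x)" if "x \<in> U" for x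
    using assms(2)[OF that] by (simp add: has_field_derivative_def)
  show "higher_differentiable_on U (\<lambda>x. f' x * v) k" for v
    using assms
    by (intro higher_differentiable_on_bounded_linear[OF _ bounded_linear_mult_left])
qed (fact assms(1))

lemma smooth_on_exp: "smooth_on UNIV (exp :: real \<Rightarrow> real)"
proof -
  have "higher_differentiable_on UNIV (exp :: real \<Rightarrow> real) k" for k
    by (induction k) (auto intro!: continuous_intros higher_differentiable_on_SucI_real DERIV_exp
        simp del: higher_differentiable_on.simps(2))
  then show ?thesis by (simp add: smooth_on_def)
qed

lemma smooth_on_sin: "smooth_on UNIV (sin :: real \<Rightarrow> real)"
  and smooth_on_cos: "smooth_on UNIV (cos :: real \<Rightarrow> real)"
proof -
  have "higher_differentiable_on UNIV (sin :: real \<Rightarrow> real) k \<and>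
      higher_differentiable_on UNIV (cos :: real \<Rightarrow> real) k" for k
  proof (induction k)
    case 0
    show ?case by (auto intro!: continuous_intros)
  next
    case (Suc k)
    have "higher_differentiable_on UNIV (\<lambda>x::real. - sin x) k"
      using Suc by (intro higher_differentiable_on_bounded_linear
          [OF _ bounded_linear_minus[OF bounded_linear_ident]]) auto
    with Suc show ?case
      by (auto intro!: higher_differentiable_on_SucI_real DERIV_sin DERIV_cos
          simp del: higher_differentiable_on.simps(2))
  qed
  then show "smooth_on UNIV (sin :: real \<Rightarrow> real)" "smooth_on UNIV (cos :: real \<Rightarrow> real)"
    by (auto simp: smooth_on_def)
qed

lemma smooth_on_ln: "smooth_on {0<..} (ln :: real \<Rightarrow> real)"
proof -
  have "higher_differentiable_on {0<..} (ln :: real \<Rightarrow> real) k" for k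
  proof (cases k)
    case 0
    then show ?thesis by (auto intro!: continuous_intros)
  next
    case (Suc j)
    have "higher_differentiable_on {0<..} (inverse :: real \<Rightarrow> real) j"
      using smooth_on_inverse[of "{0<..} :: real set"] by (auto simp: smooth_on_def)
    then show ?thesis
      unfolding Suc by (rule higher_differentiable_on_SucI_real[rotated 2])
        (auto intro!: derivative_eq_intros simp: field_simps)
  qed
  then show ?thesis by (simp add: smooth_on_def)
qed

section \<open>Smooth bump functions\<close>

text \<open>\<open>flat 0\<close> is the classical function exp(-1/x), extended by zero. The powers
  of 1/x are included because the linear span of the family is closed under differentiation.\<close>

definition flat :: "nat \<Rightarrow> real \<Rightarrow> real" where
  "flat n x = (if 0 < x then inverse x ^ n * exp (- inverse x) else 0)"

lemma flat_tendsto_0: "(flat n \<longlongrightarrow> 0) (at 0)"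
proof -
  have "((\<lambda>x::real. x ^ n / exp x) \<longlongrightarrow> 0) at_top"
    by (rule tendsto_power_div_exp_0)
  then have "((\<lambda>x::real. inverse x ^ n / exp (inverse x)) \<longlongrightarrow> 0) (at_right 0)"
    using filterlim_inverse_at_top_right by (rule filterlim_compose)
  then have "(flat n \<longlongrightarrow> 0) (at_right 0)"
    by (rule Lim_transform_eventually)
      (auto simp: eventually_at_filter flat_def exp_minus field_simps)
  moreover have "(flat n \<longlongrightarrow> 0) (at_left 0)"
    by (rule tendsto_eventually) (auto simp: eventually_at_filter flat_def)
  ultimately show ?thesis by (simp add: filterlim_at_split)
qed

lemma flat_has_derivative:
  "(flat n has_real_derivative flat (n + 2) x - real n * flat (n + 1) x) (at x)"
proof -
  consider "x < 0" | "x = 0" | "0 < x" by linarith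
  then show ?thesis
  proof cases
    case 1
    have "((\<lambda>_. 0) has_real_derivative 0) (at x)" by simp
    then have "(flat n has_real_derivative 0) (at x)"
      by (rule has_field_derivative_transform_within_open[of _ _ _ "{..<0}"])
        (use 1 in \<open>auto simp: flat_def\<close>)
    then show ?thesis using 1 by (simp add: flat_def)
  next
    case 2
    \<comment> \<open>The difference quotient of \<open>flat n\<close> at the origin is
      \<open>flat (n + 1)\<close>, whose limit there is already known.\<close>
    have "((\<lambda>y. (flat n y - flat n 0) / (y - 0)) \<longlongrightarrow> 0) (at 0)"
      by (rule Lim_transform_eventually[OF flat_tendsto_0[of "n + 1"]])
        (auto simp: eventually_at_filter flat_def field_simps)
    then have "(flat n has_real_derivative 0) (at 0)"
      by (simp add: has_field_derivative_iff)
    then show ?thesis using 2 by (simp add: flat_def)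
  next
    case 3
    have "((\<lambda>x. inverse x ^ n * exp (- inverse x)) has_real_derivative
        real n * (- (inverse x)\<^sup>2 * inverse x ^ (n - 1)) * exp (- inverse x)
        + inverse x ^ n * (exp (- inverse x) * (inverse x)\<^sup>2)) (at x)"
      using 3 by (auto intro!: derivative_eq_intros simp: power2_eq_square)
    \<comment> \<open>For \<open>n = 0\<close> the truncated exponent \<open>n - 1\<close> is
      harmless, since its coefficient vanishes.\<close>
    also have "real n * (- (inverse x)\<^sup>2 * inverse x ^ (n - 1)) * exp (- inverse x)
        + inverse x ^ n * (exp (- inverse x) * (inverse x)\<^sup>2)
        = flat (n + 2) x - real n * flat (n + 1) x"
      using 3 by (cases n) (simp_all add: flat_def power_add power2_eq_square algebra_simps)
    finally have "((\<lambda>x. inverse x ^ n * exp (- inverse x)) has_real_derivative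
        flat (n + 2) x - real n * flat (n + 1) x) (at x)" .
    then show ?thesis
      by (rule has_field_derivative_transform_within_open[of _ _ _ "{0<..}"])
        (use 3 in \<open>auto simp: flat_def\<close>)
  qed
qed

lemma smooth_on_flat: "smooth_on UNIV (flat n)"
proof -
  have "higher_differentiable_on UNIV (flat n) k" for k
  proof (induction k arbitrary: n)
    case 0
    then show ?case
      using flat_has_derivative by (auto intro!: continuous_at_imp_continuous_on DERIV_isCont)
  next
    case (Suc k)
    have "higher_differentiable_on UNIV
        (\<lambda>x. flat (n + 2) x + - (real n * flat (n + 1) x)) k"
      by (intro higher_differentiable_on_add
          higher_differentiable_on_bounded_linear[OF _ bounded_linear_minus[OF bounded_linear_ident]]
          higher_differentiable_on_bounded_linear[OF _ bounded_linear_mult_right] Suc) auto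
    then show ?case
      using flat_has_derivative by (intro higher_differentiable_on_SucI_real) auto
  qed
  then show ?thesis by (simp add: smooth_on_def)
qed

lemma smooth_bump:
  fixes R c :: real
  obtains \<alpha> :: "real \<Rightarrow> real"
  where "smooth_on UNIV \<alpha>" "\<And>t. t \<le> R \<Longrightarrow> \<alpha> t = c" "\<And>t. R + 1 \<le> t \<Longrightarrow> \<alpha> t = 0"
proof -
  \<comment> \<open>\<open>a\<close> is positive exactly for \<open>t < R + 1\<close> and
    \<open>b\<close> exactly for \<open>R < t\<close>. So \<open>a + b\<close> never vanishes, and
    \<open>a / (a + b)\<close> drops from 1 to 0 between \<open>R\<close> and
    \<open>R + 1\<close>.\<close>
  define a b where "a t = flat 0 (R + 1 - t)" and "b t = flat 0 (t - R)" for t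
  have pos: "0 < a t + b t" for t
    unfolding a_def b_def flat_def by (auto intro: add_pos_pos add_nonneg_pos)
  have a: "smooth_on UNIV a" and b: "smooth_on UNIV b"
    unfolding a_def b_def
    by (rule smooth_on_compose[OF smooth_on_flat]; simp add: smooth_on_diff smooth_on_const smooth_on_ident)+
  have "smooth_on UNIV (\<lambda>t. inverse (a t + b t))"
    by (rule smooth_on_compose[OF smooth_on_inverse[of "{0<..}"] smooth_on_add[OF open_UNIV a b]])
      (use pos in auto)
  then have "smooth_on UNIV (\<lambda>t. c * a t * inverse (a t + b t))"
    by (intro smooth_on_mult smooth_on_const a open_UNIV)
  moreover have "c * a t * inverse (a t + b t) = c" if "t \<le> R" for t
    using pos[of t] that by (simp add: b_def flat_def less_imp_neq)
  moreover have "c * a t * inverse (a t + b t) = 0" if "R + 1 \<le> t" for t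
    using that by (simp add: a_def flat_def)
  ultimately show thesis using that by blast
qed

section \<open>Ambient diffeomorphisms\<close>

text \<open>Chain rule: the derivative of a local left inverse is a left inverse of
  \<open>f'\<close>.\<close>

lemma inj_frechet_derivative:
  assumes "(f has_derivative f') (at x)" "(g has_derivative g') (at (f x))"
    and "open V" "x \<in> V" "\<And>y. y \<in> V \<Longrightarrow> g (f y) = y"
  shows "inj f'"
proof -
  have "((\<lambda>y. g (f y)) has_derivative (\<lambda>v. g' (f' v))) (at x)"
    using assms(1,2) by (rule has_derivative_compose)
  then have "((\<lambda>y. y) has_derivative (\<lambda>v. g' (f' v))) (at x)"
    using assms(3-5) by (rule has_derivative_transform_within_open)
  then have "(\<lambda>v. g' (f' v)) = (\<lambda>v. v)"
    using has_derivative_ident has_derivative_unique by blast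
  then show ?thesis by (metis injI)
qed

lemma smooth_immersion_on_compose:
  assumes "smooth_immersion_on S \<gamma>" "open V" "smooth_on V f" "\<gamma> ` S \<subseteq> V"
    and "\<And>x. x \<in> \<gamma> ` S \<Longrightarrow> inj (frechet_derivative f (at x))"
  shows "smooth_immersion_on S (f \<circ> \<gamma>)"
proof -
  obtain U g where U: "open U" "S \<subseteq> U" "smooth_on U g"
    and g: "\<And>x. x \<in> S \<Longrightarrow> g x = \<gamma> x" "\<And>x. x \<in> S \<Longrightarrow> inj (frechet_derivative g (at x))"
    using assms(1) unfolding smooth_immersion_on_def by blast
  \<comment> \<open>The smooth extension \<open>g\<close> of the curve may leave \<open>V\<close>
    away from \<open>S\<close>, so it is restricted to the preimage of \<open>V\<close>.\<close>
  let ?W = "U \<inter> g -` V"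
  have "open ?W"
    using U assms(2) smooth_on_continuous_on by (intro continuous_open_preimage) auto
  moreover have "smooth_on ?W (\<lambda>x. f (g x))"
    by (rule smooth_on_compose[OF assms(3) smooth_on_subset[OF U(3)]])
      (use assms(2) \<open>open ?W\<close> in auto)
  moreover have "S \<subseteq> ?W" using U(2) assms(4) g(1) by auto
  moreover have "inj (frechet_derivative (\<lambda>x. f (g x)) (at x))" if "x \<in> S" for x
  proof -
    have "(g has_derivative frechet_derivative g (at x)) (at x)"
      using U that by (auto intro: smooth_on_has_derivative)
    moreover have "(f has_derivative frechet_derivative f (at (g x))) (at (g x))"
      using assms(3,4) g(1) that by (auto intro: smooth_on_has_derivative)
    ultimately have "((\<lambda>x. f (g x)) has_derivative
        (\<lambda>v. frechet_derivative f (at (g x)) (frechet_derivative g (at x) v))) (at x)"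
      by (rule has_derivative_compose)
    then have "frechet_derivative (\<lambda>x. f (g x)) (at x)
        = frechet_derivative f (at (g x)) \<circ> frechet_derivative g (at x)"
      using frechet_derivative_at by (fastforce simp: comp_def)
    then show ?thesis
      using g that assms(5)[of "\<gamma> x"] by (auto intro: inj_compose)
  qed
  ultimately show ?thesis
    unfolding smooth_immersion_on_def using g(1) by (intro exI[of _ ?W] exI[of _ "\<lambda>x. f (g x)"]) auto
qed

lemma piecewise_smooth_curve_compose:
  assumes "piecewise_smooth_curve \<gamma>" "open V" "smooth_on V f" "path_image \<gamma> \<subseteq> V"
    and "\<And>x. x \<in> path_image \<gamma> \<Longrightarrow> inj (frechet_derivative f (at x))"
  shows "piecewise_smooth_curve (f \<circ> \<gamma>)"
proof -
  obtain T where T: "finite T" "{0, 1} \<subseteq> T" "T \<subseteq> {0..1}"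
    "\<And>a b. a \<in> T \<Longrightarrow> b \<in> T \<Longrightarrow> a < b \<and> {a<..<b} \<inter> T = {} \<Longrightarrow> smooth_immersion_on {a..b} \<gamma>"
    and "path \<gamma>"
    using assms(1) unfolding piecewise_smooth_curve_def by metis
  have "smooth_immersion_on {a..b} (f \<circ> \<gamma>)"
    if "a \<in> T" "b \<in> T" "a < b \<and> {a<..<b} \<inter> T = {}" for a b
  proof (rule smooth_immersion_on_compose[OF T(4)[OF that] assms(2,3)])
    have sub: "\<gamma> ` {a..b} \<subseteq> path_image \<gamma>"
      using that T(3) by (fastforce simp: path_image_def)
    then show "\<gamma> ` {a..b} \<subseteq> V" using assms(4) by blast
    show "inj (frechet_derivative f (at x))" if "x \<in> \<gamma> ` {a..b}" for x
      using that sub assms(5) by blast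
  qed
  moreover have "path (f \<circ> \<gamma>)"
    using \<open>path \<gamma>\<close> assms(3,4) smooth_on_continuous_on
    by (intro path_continuous_image) (auto intro: continuous_on_subset)
  ultimately show ?thesis
    unfolding piecewise_smooth_curve_def using T by blast
qed

text \<open>Smooth on all of space, unlike the maps in \<open>link_homeomorphic\<close>: this class
  is closed under composition, and the single polyhedral piece \<open>UNIV\<close> shows that its
  members are piecewise smooth homeomorphisms.\<close>

definition ambient_diffeomorphism :: "(real^3 \<Rightarrow> real^3) \<Rightarrow> bool" where
  "ambient_diffeomorphism f \<longleftrightarrow> orientation_preserving f \<and>
     (\<exists>g. smooth_on UNIV f \<and> smooth_on UNIV g \<and> (\<forall>x. g (f x) = x) \<and> (\<forall>x. f (g x) = x))"

lemma inj_frechet_derivative_diffeomorphism: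
  fixes f :: "real^3 \<Rightarrow> real^3"
  assumes "smooth_on UNIV f" "smooth_on UNIV g" "\<And>x. g (f x) = x"
  shows "inj (frechet_derivative f (at x))"
proof (rule inj_frechet_derivative[where V=UNIV])
  show "(f has_derivative frechet_derivative f (at x)) (at x)"
    "(g has_derivative frechet_derivative g (at (f x))) (at (f x))"
    using assms by (auto intro: smooth_on_has_derivative)
qed (use assms in auto)

lemma ambient_diffeomorphism_imp_homeomorphism:
  assumes "ambient_diffeomorphism f"
  shows "piecewise_smooth_homeomorphism f"
proof -
  obtain g where g: "smooth_on UNIV f" "smooth_on UNIV g" "\<And>x. g (f x) = x" "\<And>x. f (g x) = x"
    using assms unfolding ambient_diffeomorphism_def by blast
  then have "homeomorphism UNIV UNIV f g"
    unfolding homeomorphism_def by (auto simp: smooth_on_continuous_on image_iff) metis+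
  moreover have "smooth_immersion_on UNIV f"
    unfolding smooth_immersion_on_def
    using g inj_frechet_derivative_diffeomorphism[of f g] by (intro exI[of _ UNIV] exI[of _ f]) auto
  moreover have "locally_finite_in euclidean {UNIV :: (real^3) set}"
    by (rule finite_imp_locally_finite_in) auto
  ultimately show ?thesis
    unfolding piecewise_smooth_homeomorphism_def by (auto intro!: exI[of _ "{UNIV}"])
qed

lemma det_matrix_nonzero:
  fixes f' :: "real^'n \<Rightarrow> real^'n"
  assumes "linear f'" "inj f'"
  shows "Determinants.det (matrix f') \<noteq> 0"
  using assms by (metis det_nz_iff_inj)

text \<open>The Jacobian determinant is continuous and, by invertibility, nowhere zero. As space is
  connected, its sign at the single point \<open>x0\<close> decides it everywhere.\<close>

lemma ambient_diffeomorphismI: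
  fixes f g :: "real^3 \<Rightarrow> real^3"
  assumes f: "smooth_on UNIV f" and g: "smooth_on UNIV g" "\<And>x. g (f x) = x" "\<And>x. f (g x) = x"
    and "(f has_derivative f') (at x0)" "0 < Determinants.det (matrix f')"
  shows "ambient_diffeomorphism f"
proof -
  let ?d = "\<lambda>x. Determinants.det (matrix (frechet_derivative f (at x)))"
  have der: "(f has_derivative frechet_derivative f (at x)) (at x)" for x
    using f by (auto intro: smooth_on_has_derivative)
  have nz: "?d x \<noteq> 0" for x
    using inj_frechet_derivative_diffeomorphism[OF f g(1,2)] der
    by (intro det_matrix_nonzero) (auto intro: has_derivative_linear)
  have "continuous_on UNIV ?d"
    unfolding Determinants.det_def matrix_def
    using smooth_on_continuous_on[OF smooth_on_frechet_derivative[OF f]]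
    by (auto intro!: continuous_intros)
  then have conn: "connected (range ?d)"
    by (intro connected_continuous_image connected_UNIV)
  have x0: "0 < ?d x0"
    using assms(5,6) frechet_derivative_at by metis
  have "0 < ?d x" for x
  proof (rule ccontr)
    assume "\<not> 0 < ?d x"
    then have "0 \<in> range ?d"
      using x0 connectedD_interval[OF conn, of "?d x" "?d x0" 0] by auto
    with nz show False by (metis (no_types, lifting) imageE)
  qed
  then have "orientation_preserving f"
    unfolding orientation_preserving_def using frechet_derivative_at by metis
  with f g show ?thesis
    unfolding ambient_diffeomorphism_def by blast
qed

lemma ambient_diffeomorphism_compose:
  assumes "ambient_diffeomorphism f" "ambient_diffeomorphism g"
  shows "ambient_diffeomorphism (g \<circ> f)"
proof -
  obtain f1 where f: "smooth_on UNIV f" "smooth_on UNIV f1" "\<And>x. f1 (f x) = x" "\<And>x. f (f1 x) = x"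
    "orientation_preserving f"
    using assms(1) unfolding ambient_diffeomorphism_def by blast
  obtain g1 where g: "smooth_on UNIV g" "smooth_on UNIV g1" "\<And>x. g1 (g x) = x" "\<And>x. g (g1 x) = x"
    "orientation_preserving g"
    using assms(2) unfolding ambient_diffeomorphism_def by blast
  let ?f' = "frechet_derivative f (at 0)" and ?g' = "frechet_derivative g (at (f 0))"
  have der: "(f has_derivative ?f') (at 0)" "(g has_derivative ?g') (at (f 0))"
    using f(1) g(1) by (auto intro: smooth_on_has_derivative)
  then have "0 < Determinants.det (matrix (?g' \<circ> ?f'))"
    using f(5) g(5) der[THEN has_derivative_linear]
    by (auto simp: matrix_compose Determinants.det_mul orientation_preserving_def)
  moreover have "((g \<circ> f) has_derivative (?g' \<circ> ?f')) (at 0)"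
    using der by (rule diff_chain_at)
  moreover have "smooth_on UNIV (g \<circ> f)" "smooth_on UNIV (f1 \<circ> g1)"
    unfolding comp_def
    using smooth_on_compose[OF g(1) f(1)] smooth_on_compose[OF f(2) g(2)] by auto
  ultimately show ?thesis
    using f g by (intro ambient_diffeomorphismI[where g="f1 \<circ> g1"]) auto
qed

lemma ambient_diffeomorphism_rotation:
  fixes Q :: "real^3^3"
  assumes "rotation_matrix Q"
  shows "ambient_diffeomorphism ((*v) Q)"
proof (rule ambient_diffeomorphismI)
  have "orthogonal_matrix Q" using assms by (simp add: rotation_matrix_def)
  then show "Finite_Cartesian_Product.transpose Q *v (Q *v x) = x"
    "Q *v (Finite_Cartesian_Product.transpose Q *v x) = x" for x
    by (simp_all add: matrix_vector_mul_assoc orthogonal_matrix_def del: transpose_matrix_vector)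
  show "smooth_on UNIV ((*v) Q)" "smooth_on UNIV ((*v) (Finite_Cartesian_Product.transpose Q))"
    by (auto intro!: smooth_on_linear matrix_vector_mul_bounded_linear)
  show "((*v) Q has_derivative (*v) Q) (at 0)"
    by (rule bounded_linear_imp_has_derivative) (rule matrix_vector_mul_bounded_linear)
  show "0 < Determinants.det (matrix ((*v) Q))"
    using assms by (simp add: rotation_matrix_def)
qed

lemma ambient_diffeomorphism_translation: "ambient_diffeomorphism (\<lambda>x. x + a)"
proof (rule ambient_diffeomorphismI[where g="\<lambda>x. x - a"])
  show "((\<lambda>x. x + a) has_derivative (\<lambda>x. x)) (at 0)"
    by (auto intro!: derivative_eq_intros)
  show "0 < Determinants.det (matrix (\<lambda>x::real^3. x))"
    by (simp add: matrix_id_mat_1[unfolded id_def])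
qed (auto intro!: smooth_on_add smooth_on_diff smooth_on_const smooth_on_ident)

section \<open>Links under ambient diffeomorphisms\<close>

lemma parametrizes_link_image:
  assumes "parametrizes_link \<Gamma> K" "ambient_diffeomorphism f"
  shows "parametrizes_link ((\<circ>) f ` \<Gamma>) (f ` K)"
proof -
  obtain g where g: "smooth_on UNIV f" "smooth_on UNIV g" "\<And>x. g (f x) = x" "\<And>x. f (g x) = x"
    using assms(2) unfolding ambient_diffeomorphism_def by blast
  then have inj: "inj f" by (metis injI)
  have cont: "continuous_on S f" for S
    using smooth_on_continuous_on[OF g(1)] continuous_on_subset by blast
  have 1: "simple_path (f \<circ> \<gamma>)" "pathfinish (f \<circ> \<gamma>) = pathstart (f \<circ> \<gamma>)" "piecewise_smooth_curve (f \<circ> \<gamma>)"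
    if "\<gamma> \<in> \<Gamma>" for \<gamma>
  proof -
    have \<gamma>: "simple_path \<gamma>" "pathfinish \<gamma> = pathstart \<gamma>" "piecewise_smooth_curve \<gamma>"
      using assms(1) that by (auto simp: parametrizes_link_def)
    show "simple_path (f \<circ> \<gamma>)"
      using \<gamma>(1) cont inj by (intro simple_path_continuous_image) (auto intro: inj_on_subset)
    show "pathfinish (f \<circ> \<gamma>) = pathstart (f \<circ> \<gamma>)"
      using \<gamma>(2) by (simp add: pathfinish_compose pathstart_compose)
    show "piecewise_smooth_curve (f \<circ> \<gamma>)"
      using \<gamma>(3) g inj_frechet_derivative_diffeomorphism[of f g]
      by (intro piecewise_smooth_curve_compose[where V=UNIV]) auto
  qed
  have "path_image (f \<circ> \<gamma>) \<inter> path_image (f \<circ> \<delta>) = {}"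
    if "\<gamma> \<in> \<Gamma>" "\<delta> \<in> \<Gamma>" "f \<circ> \<gamma> \<noteq> f \<circ> \<delta>" for \<gamma> \<delta>
  proof -
    have "pairwise (\<lambda>\<gamma> \<delta>. path_image \<gamma> \<inter> path_image \<delta> = {}) \<Gamma>" "\<gamma> \<noteq> \<delta>"
      using assms(1) that(3) by (auto simp: parametrizes_link_def)
    then have "path_image \<gamma> \<inter> path_image \<delta> = {}"
      using that(1,2) unfolding pairwise_def by blast
    then show ?thesis
      using inj by (auto simp: path_image_compose dest: injD)
  qed
  with assms(1) 1 show ?thesis
    by (auto simp: parametrizes_link_def pairwise_def path_image_compose)
qed

lemma link_type_image:
  assumes "K \<in> link_type L" "ambient_diffeomorphism f"
  shows "f ` K \<in> link_type L"
proof -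
  have "is_link K" "equivclp link_homeomorphic L K"
    using assms(1) by (auto simp: link_type_def)
  moreover have "is_link (f ` K)"
    using \<open>is_link K\<close> parametrizes_link_image[OF _ assms(2)] unfolding is_link_def by blast
  moreover have "link_homeomorphic K (f ` K)"
    unfolding link_homeomorphic_def
    using calculation assms(2) ambient_diffeomorphism_imp_homeomorphism[OF assms(2)]
    by (auto simp: ambient_diffeomorphism_def)
  ultimately show ?thesis
    unfolding link_type_def by (auto intro: equivclp_into_equivclp)
qed

section \<open>Twisting half-planes around the axis\<close>

lemma smooth_on_vector_3:
  assumes "open U" "smooth_on U f" "smooth_on U g" "smooth_on U h"
  shows "smooth_on U (\<lambda>x. vector [f x, g x, h x] :: real^3)"
proof -
  have "(vector [a, b, c] :: real^3) = a *\<^sub>R axis 1 1 + b *\<^sub>R axis 2 1 + c *\<^sub>R axis 3 1" for a b c :: real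
    by (simp add: Finite_Cartesian_Product.vec_eq_iff forall_3 axis_def)
  then show ?thesis
    using assms by (simp add: smooth_on_add smooth_on_scaleR smooth_on_const)
qed

lemma vector_3_components: "vector [x$1, x$2, x$3] = (x :: 'a::zero^3)"
  by (simp add: Finite_Cartesian_Product.vec_eq_iff forall_3)

text \<open>The coordinate \<open>s\<close>: the logarithm of the distance from the vertical axis,
  written without a square root.\<close>

definition half_log :: "real^3 \<Rightarrow> real" where
  "half_log x = ln ((x$1)\<^sup>2 + (x$2)\<^sup>2) / 2"

text \<open>Rotates the point $(s, h)$ of each half-plane bounded by the axis by the angle
  $\alpha(s^2 + h^2)$.\<close>

definition twist :: "(real \<Rightarrow> real) \<Rightarrow> real^3 \<Rightarrow> real^3" where
  "twist \<alpha> x =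
     (if x$1 = 0 \<and> x$2 = 0 then x
      else let s = half_log x; a = \<alpha> (s\<^sup>2 + (x$3)\<^sup>2); e = exp (cos a * s - sin a * x$3 - s)
           in vector [e * x$1, e * x$2, sin a * s + cos a * x$3])"

lemma twist_off_axis:
  assumes "\<not> (x$1 = 0 \<and> x$2 = 0)"
  shows "twist \<alpha> x =
     (let s = half_log x; a = \<alpha> (s\<^sup>2 + (x$3)\<^sup>2); e = exp (cos a * s - sin a * x$3 - s)
      in vector [e * x$1, e * x$2, sin a * s + cos a * x$3])"
  unfolding twist_def by (rule if_not_P[OF assms])

lemma exp_half_log:
  assumes "\<not> (x$1 = 0 \<and> x$2 = 0)"
  shows "exp (2 * half_log x) = (x$1)\<^sup>2 + (x$2)\<^sup>2"
  using assms by (simp add: half_log_def sum_power2_gt_zero_iff)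

text \<open>Horizontal scaling by \<open>exp r\<close> translates \<open>s\<close> by
  \<open>r\<close> and keeps the angle around the axis. This explains the factor \<open>e\<close> in
  \<open>twist\<close>: its exponent is the rotated value of \<open>s\<close> minus the old
  one.\<close>

lemma half_log_scaled:
  assumes "\<not> (x$1 = 0 \<and> x$2 = 0)" "y$1 = exp r * x$1" "y$2 = exp r * x$2"
  shows "half_log y = r + half_log x"
proof -
  have "exp (2 * half_log y) = (y$1)\<^sup>2 + (y$2)\<^sup>2"
    using assms by (intro exp_half_log) auto
  also have "\<dots> = (exp r)\<^sup>2 * exp (2 * half_log x)"
    by (simp only: exp_half_log[OF assms(1)] assms(2,3) power_mult_distrib ring_distribs)
  also have "\<dots> = exp (2 * (r + half_log x))"
    by (simp add: exp_add ring_distribs flip: exp_double)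
  finally show ?thesis by simp
qed

text \<open>A rotation of the \<open>(s, h)\<close>-plane preserves \<open>s^2 + h^2\<close>, the
  only quantity on which the angle depends. The second twist therefore turns back by the very angle
  of the first.\<close>

lemma twist_inverse: "twist (\<lambda>t. - \<alpha> t) (twist \<alpha> x) = x"
proof (cases "x$1 = 0 \<and> x$2 = 0")
  case True
  then show ?thesis by (simp add: twist_def)
next
  case False
  define s where "s = half_log x"
  define a where "a = \<alpha> (s\<^sup>2 + (x$3)\<^sup>2)"
  define s' where "s' = cos a * s - sin a * x$3"
  define h' where "h' = sin a * s + cos a * x$3"
  define y where "y = twist \<alpha> x"
  have y: "y$1 = exp (s' - s) * x$1" "y$2 = exp (s' - s) * x$2" "y$3 = h'"
    by (simp_all add: y_def twist_off_axis[OF False] Let_def s_def s'_def a_def h'_def)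
  have y0: "\<not> (y$1 = 0 \<and> y$2 = 0)"
    using False y by simp
  have s': "half_log y = s'"
    using half_log_scaled[OF False y(1,2)] by (simp add: s_def)
  have sc: "(sin a)\<^sup>2 = 1 - (cos a)\<^sup>2" by (simp add: sin_squared_eq)
  have norm: "s'\<^sup>2 + h'\<^sup>2 = s\<^sup>2 + (x$3)\<^sup>2"
    unfolding s'_def h'_def
    by (simp add: power2_sum power2_diff power_mult_distrib sc algebra_simps)
  \<comment> \<open>A rotation matrix multiplied by its transpose, with \<open>c\<close> and
    \<open>d\<close> standing for cosine and sine.\<close>
  have rot: "c * (c * u - d * v) + d * (d * u + c * v) = (c\<^sup>2 + d\<^sup>2) * u"
    "c * (d * u + c * v) - d * (c * u - d * v) = (c\<^sup>2 + d\<^sup>2) * v" for c d u v :: real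
    by (simp_all add: algebra_simps power2_eq_square)
  have "cos a * s' + sin a * h' = ((cos a)\<^sup>2 + (sin a)\<^sup>2) * s"
    unfolding s'_def h'_def by (rule rot)
  then have 1: "cos a * s' + sin a * h' = s" by simp
  have "cos a * h' - sin a * s' = ((cos a)\<^sup>2 + (sin a)\<^sup>2) * x$3"
    unfolding s'_def h'_def by (rule rot)
  then have 2: "cos a * h' - sin a * s' = x$3" by simp
  have "twist (\<lambda>t. - \<alpha> t) y = vector [exp (s - s') * y$1, exp (s - s') * y$2, x$3]"
    using 1 2 by (simp add: twist_off_axis[OF y0] Let_def s' y(3) norm flip: a_def)
  also have "\<dots> = x"
    by (simp add: Finite_Cartesian_Product.vec_eq_iff forall_3 y(1,2) mult.assoc[symmetric] flip: exp_add)
  finally show ?thesis by (simp add: y_def)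
qed

lemma twist_eq_ident:
  assumes "\<And>t. M \<le> t \<Longrightarrow> \<alpha> t = 0" "(half_log x)\<^sup>2 \<ge> M"
  shows "twist \<alpha> x = x"
proof -
  have "\<alpha> ((half_log x)\<^sup>2 + (x$3)\<^sup>2) = 0"
    using assms(2) by (intro assms(1)) (simp add: add_increasing2)
  then show ?thesis
    by (simp add: twist_def Let_def vector_3_components)
qed

text \<open>Towards the axis \<open>s\<close> tends to minus infinity uniformly in the height, so
  \<open>s^2\<close> alone passes the threshold \<open>M\<close> on a whole cylinder.\<close>

lemma twist_ident_near_axis:
  assumes "\<And>t. M \<le> t \<Longrightarrow> \<alpha> t = 0"
  shows "\<exists>U. open U \<and> {x. x$1 = 0 \<and> x$2 = 0} \<subseteq> U \<and> (\<forall>x\<in>U. twist \<alpha> x = x)"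
proof (intro exI conjI ballI)
  \<comment> \<open>Off the axis, the cylinder chosen below is where
    \<open>half_log x < - N\<close>. Taking \<open>N\<close> at least 1 gives
    \<open>M <= N <= N * N\<close>.\<close>
  define N where "N = max M 1"
  show "open {x::real^3. (x$1)\<^sup>2 + (x$2)\<^sup>2 < exp (- 2 * N)}"
    by (intro open_Collect_less continuous_intros)
  show "{x::real^3. x$1 = 0 \<and> x$2 = 0} \<subseteq> {x. (x$1)\<^sup>2 + (x$2)\<^sup>2 < exp (- 2 * N)}"
    by auto
  show "twist \<alpha> x = x" if "x \<in> {x. (x$1)\<^sup>2 + (x$2)\<^sup>2 < exp (- 2 * N)}" for x
  proof (cases "x$1 = 0 \<and> x$2 = 0")
    case True
    then show ?thesis by (simp add: twist_def)
  next
    case False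
    then have "exp (2 * half_log x) < exp (- 2 * N)"
      using that by (simp add: exp_half_log)
    then have "N < - half_log x" by simp
    then have "N * N \<le> (- half_log x) * (- half_log x)"
      by (intro mult_mono) (auto simp: N_def)
    moreover have "M \<le> N * N"
      using mult_left_mono[of 1 N N] by (auto simp: N_def)
    ultimately have "M \<le> (half_log x)\<^sup>2" by (simp add: power2_eq_square)
    with assms show ?thesis by (rule twist_eq_ident)
  qed
qed

lemma smooth_on_twist:
  assumes "smooth_on UNIV \<alpha>" "\<And>t. M \<le> t \<Longrightarrow> \<alpha> t = 0"
  shows "smooth_on UNIV (twist \<alpha>)"
proof -
  obtain U where U: "open U" "{x. x$1 = 0 \<and> x$2 = 0} \<subseteq> U" "\<And>x. x \<in> U \<Longrightarrow> twist \<alpha> x = x"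
    using twist_ident_near_axis[of M \<alpha>, OF assms(2)] by blast
  have "smooth_on U (twist \<alpha>)"
    using smooth_on_cong[OF U(1), of "twist \<alpha>" "\<lambda>x. x"] U(3) smooth_on_ident[OF U(1)] by blast
  moreover
  define W where "W = {x::real^3. 0 < (x$1)\<^sup>2 + (x$2)\<^sup>2}"
  have W: "open W"
    unfolding W_def by (intro open_Collect_less continuous_intros)
  have nth: "smooth_on W (\<lambda>x. x $ i)" for i
    by (rule smooth_on_linear[OF W bounded_linear_vec_nth])
  note I = smooth_on_add[OF W] smooth_on_diff[OF W] smooth_on_mult[OF W] smooth_on_const[OF W] nth
  have s: "smooth_on W half_log"
  proof -
    have "smooth_on W (\<lambda>x. (x$1) * (x$1) + (x$2) * (x$2))"
      by (intro I)
    then have "smooth_on W (\<lambda>x. ln (x$1 * x$1 + x$2 * x$2))"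
      by (rule smooth_on_compose[OF smooth_on_ln _ W]) (auto simp: W_def power2_eq_square)
    then have "smooth_on W (\<lambda>x. ln (x$1 * x$1 + x$2 * x$2) * (1 / 2))"
      by (intro I)
    then show ?thesis
      by (simp add: half_log_def[abs_def] power2_eq_square)
  qed
  define a where "a x = \<alpha> (half_log x * half_log x + x$3 * x$3)" for x :: "real^3"
  have "smooth_on W (\<lambda>x. half_log x * half_log x + x$3 * x$3)"
    by (intro I s)
  then have a: "smooth_on W a"
    unfolding a_def by (rule smooth_on_compose[OF assms(1) _ W]) auto
  have sin: "smooth_on W (\<lambda>x. sin (a x))" and cos: "smooth_on W (\<lambda>x. cos (a x))"
    by (rule smooth_on_compose[OF smooth_on_sin a W], simp_all)
      (rule smooth_on_compose[OF smooth_on_cos a W], simp_all)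
  define r where "r x = cos (a x) * half_log x - sin (a x) * x$3 - half_log x" for x
  have "smooth_on W r"
    unfolding r_def by (intro I s sin cos)
  then have e: "smooth_on W (\<lambda>x. exp (r x))"
    by (rule smooth_on_compose[OF smooth_on_exp _ W]) auto
  have "smooth_on W (\<lambda>x. vector [exp (r x) * x$1, exp (r x) * x$2,
      sin (a x) * half_log x + cos (a x) * x$3] :: real^3)"
    by (intro smooth_on_vector_3[OF W] I s sin cos e)
  then have "smooth_on W (twist \<alpha>)"
    by (subst smooth_on_cong[OF W])
      (auto simp: W_def twist_def Let_def a_def r_def power2_eq_square)
  moreover have "U \<union> W = UNIV"
    using U(2) by (auto simp: W_def sum_power2_gt_zero_iff)
  ultimately show ?thesis
    using smooth_on_Un[OF U(1) W] by metis
qed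

lemma ambient_diffeomorphism_twist:
  assumes "smooth_on UNIV \<alpha>" "\<And>t. M \<le> t \<Longrightarrow> \<alpha> t = 0"
  shows "ambient_diffeomorphism (twist \<alpha>)"
proof (rule ambient_diffeomorphismI)
  show "smooth_on UNIV (twist \<alpha>)" "smooth_on UNIV (twist (\<lambda>t. - \<alpha> t))"
    using assms by (auto intro!: smooth_on_twist[where M=M] smooth_on_minus)
  show "twist (\<lambda>t. - \<alpha> t) (twist \<alpha> x) = x" for x
    by (rule twist_inverse)
  show "twist \<alpha> (twist (\<lambda>t. - \<alpha> t) x) = x" for x
    using twist_inverse[of "\<lambda>t. - \<alpha> t"] by simp
  obtain U where U: "open U" "{x. x$1 = 0 \<and> x$2 = 0} \<subseteq> U" "\<And>x. x \<in> U \<Longrightarrow> twist \<alpha> x = x"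
    using twist_ident_near_axis[of M \<alpha>, OF assms(2)] by blast
  \<comment> \<open>The origin lies on the axis, and near the axis the twist is the identity; so the
    orientation is tested there.\<close>
  show "(twist \<alpha> has_derivative (\<lambda>x. x)) (at 0)"
    using U by (intro has_derivative_transform_within_open[OF has_derivative_ident U(1)]) auto
  show "0 < Determinants.det (matrix (\<lambda>x::real^3. x))"
    by (simp add: matrix_id_mat_1[unfolded id_def])
qed

lemma ambient_diffeomorphism_inversion:
  fixes K :: "(real^3) set"
  assumes "compact K" "\<And>x. x \<in> K \<Longrightarrow> \<not> (x$1 = 0 \<and> x$2 = 0)"
  obtains f where "ambient_diffeomorphism f"
    "\<And>x. x \<in> K \<Longrightarrow> f x = vector [x$1 / ((x$1)\<^sup>2 + (x$2)\<^sup>2), x$2 / ((x$1)\<^sup>2 + (x$2)\<^sup>2), - x$3]"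
proof -
  let ?t = "\<lambda>x. (half_log x)\<^sup>2 + (x$3)\<^sup>2"
  have "continuous_on K ?t"
    unfolding half_log_def using assms(2) by (intro continuous_intros) (auto simp: sum_power2_eq_zero_iff)
  then have "bounded (?t ` K)"
    using assms(1) by (intro compact_imp_bounded compact_continuous_image)
  then obtain R where "\<And>x. x \<in> K \<Longrightarrow> norm (?t x) \<le> R"
    by (auto simp: bounded_iff)
  then have R: "\<And>x. x \<in> K \<Longrightarrow> ?t x \<le> R" by force
  \<comment> \<open>By compactness one radius \<open>R\<close> serves all of \<open>K\<close>. The
    angle \<open>pi\<close> sends \<open>(s, h)\<close> to \<open>(- s, - h)\<close>, so on
    \<open>K\<close> the horizontal factor is \<open>exp (- 2 * s)\<close>, the inverse square of
    the distance from the axis.\<close>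
  obtain \<alpha> :: "real \<Rightarrow> real" where \<alpha>: "smooth_on UNIV \<alpha>" "\<And>t. t \<le> R \<Longrightarrow> \<alpha> t = pi"
    "\<And>t. R + 1 \<le> t \<Longrightarrow> \<alpha> t = 0"
    using smooth_bump[of R pi] by blast
  have "twist \<alpha> x = vector [x$1 / ((x$1)\<^sup>2 + (x$2)\<^sup>2), x$2 / ((x$1)\<^sup>2 + (x$2)\<^sup>2), - x$3]"
    if "x \<in> K" for x
  proof -
    have "exp (- (half_log x * 2)) = inverse ((x$1)\<^sup>2 + (x$2)\<^sup>2)"
      unfolding exp_half_log[OF assms(2)[OF that], symmetric] by (simp add: mult.commute flip: exp_minus)
    then show ?thesis
      using \<alpha>(2)[OF R[OF that]]
      by (simp add: twist_off_axis[OF assms(2)[OF that]] Let_def divide_inverse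
          mult.commute)
  qed
  with ambient_diffeomorphism_twist[OF \<alpha>(1,3)] show thesis by (rule that)
qed

section \<open>Conformal changes of the plane of projection\<close>

lemma bounded_linear_proj: "bounded_linear proj"
proof (rule linear_conv_bounded_linear[THEN iffD1], rule linearI)
  show "proj (x + y) = proj x + proj y" "proj (r *\<^sub>R x) = r *\<^sub>R proj x" for x y r
    by (simp_all add: proj_def complex_eq_iff)
qed

lemma proj_0 [simp]: "proj 0 = 0"
  by (simp add: proj_def complex_eq_iff)

lemma real3_eqI: "proj x = proj y \<Longrightarrow> x $ 3 = y $ 3 \<Longrightarrow> x = y"
  by (simp add: proj_def Finite_Cartesian_Product.vec_eq_iff forall_3)

definition space_point :: "complex \<times> real \<Rightarrow> real^3" where
  "space_point w = vector [Re (fst w), Im (fst w), snd w]"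

lemma proj_space_point [simp]: "proj (space_point w) = fst w"
  by (simp add: proj_def space_point_def)

lemma space_point_3 [simp]: "space_point w $ 3 = snd w"
  by (simp add: space_point_def)

lemma bounded_linear_space_point: "bounded_linear space_point"
proof (rule linear_conv_bounded_linear[THEN iffD1], rule linearI)
  show "space_point (x + y) = space_point x + space_point y" for x y
    by (rule real3_eqI)
      (simp_all add: linear_add[OF bounded_linear.linear[OF bounded_linear_proj]])
  show "space_point (r *\<^sub>R x) = r *\<^sub>R space_point x" for x and r :: real
    by (rule real3_eqI)
      (simp_all add: linear_scale[OF bounded_linear.linear[OF bounded_linear_proj]])
qed

text \<open>Over and under are decided by comparing third coordinates, which stay as they
  are.\<close>

definition lift :: "(complex \<Rightarrow> complex) \<Rightarrow> real^3 \<Rightarrow> real^3" where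
  "lift m x = space_point (m (proj x), x $ 3)"

lemma proj_lift [simp]: "proj (lift m x) = m (proj x)"
  and lift_3 [simp]: "lift m x $ 3 = x $ 3"
  by (simp_all add: lift_def)

lemma lift_lift: "(\<And>z. n (m z) = z) \<Longrightarrow> lift n (lift m x) = x"
  by (rule real3_eqI) simp_all

lemma image_components:
  assumes "homeomorphism S T f g"
  shows "components T = (`) f ` components S"
proof -
  \<comment> \<open>Proved for arbitrary homeomorphisms, so that it applies to \<open>g\<close> as
    well and yields the converse inclusion.\<close>
  have le: "(`) f ` components S \<subseteq> components T"
    if hom: "homeomorphism S T f g" for S T and f :: "'c::topological_space \<Rightarrow> 'd::topological_space" and g
  proof
    fix D assume "D \<in> (`) f ` components S"
    then obtain C where C: "C \<in> components S" "D = f ` C" by blast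
    have fg: "\<And>x. x \<in> S \<Longrightarrow> g (f x) = x" "\<And>y. y \<in> T \<Longrightarrow> f (g y) = y" "f ` S = T" "g ` T = S"
      "continuous_on S f" "continuous_on T g"
      using hom by (auto simp: homeomorphism_def)
    have CS: "C \<noteq> {}" "C \<subseteq> S" "connected C"
      using in_components_nonempty[OF C(1)] in_components_subset[OF C(1)]
        in_components_connected[OF C(1)] by auto
    have max: "E = C" if "C \<subseteq> E" "E \<subseteq> S" "connected E" for E
      using components_maximal[OF C(1) that(3,2)] that(1) CS(1) by blast
    show "D \<in> components T"
      unfolding in_components_maximal C(2)
    proof (intro conjI allI impI)
      show "f ` C \<noteq> {}" "f ` C \<subseteq> T" using CS fg by auto
      show "connected (f ` C)"
        using CS fg by (intro connected_continuous_image) (auto intro: continuous_on_subset)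
      fix E assume E: "E \<noteq> {} \<and> f ` C \<subseteq> E \<and> E \<subseteq> T \<and> connected E"
      have "g ` E = C"
      proof (rule max)
        show "C \<subseteq> g ` E"
        proof
          fix x assume "x \<in> C"
          then have "g (f x) = x" "f x \<in> E" using E CS(2) fg(1) by blast+
          then show "x \<in> g ` E" by (metis imageI)
        qed
        show "g ` E \<subseteq> S" using E fg(4) by blast
        show "connected (g ` E)"
          using E fg by (intro connected_continuous_image) (auto intro: continuous_on_subset)
      qed
      then have "f ` C = f ` g ` E" by simp
      moreover have "f ` g ` E = E"
        unfolding image_image using E fg(2) by (intro image_cong[where g="\<lambda>y. y", simplified]) auto
      ultimately show "E = f ` C" by simp
    qed
  qed
  show ?thesis
  proof
    show "(`) f ` components S \<subseteq> components T" by (rule le[OF assms])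
    show "components T \<subseteq> (`) f ` components S"
    proof
      fix D assume D: "D \<in> components T"
      then have "g ` D \<in> components S"
        using le[OF homeomorphism_symD[OF assms]] by blast
      moreover have "f ` g ` D = D"
        unfolding image_image using in_components_subset[OF D] assms
        by (intro image_cong[where g="\<lambda>y. y", simplified]) (auto simp: homeomorphism_def)
      ultimately show "D \<in> (`) f ` components S" by (metis imageI)
    qed
  qed
qed

text \<open>The model is \<open>m z = inverse (z - p)\<close>, \<open>n w = inverse w + p\<close>, \<open>q = 0\<close>. The junk value
  \<open>inverse 0 = 0\<close> makes these mutually inverse bijections of the plane, and the assumptions
  symmetric in \<open>m\<close> and \<open>n\<close>; geometrically, \<open>m\<close> sends \<open>p\<close> to infinity and infinity to \<open>q\<close>.\<close>

locale punctured_conformal =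
  fixes m n :: "complex \<Rightarrow> complex" and p q :: complex
  assumes nm [simp]: "n (m z) = z" and mn [simp]: "m (n w) = w" and mp: "m p = q"
    and differentiable_m: "z \<noteq> p \<Longrightarrow> m field_differentiable (at z)"
    and differentiable_n: "w \<noteq> q \<Longrightarrow> n field_differentiable (at w)"
    and m_pole: "filterlim m at_infinity (at p)" and n_pole: "filterlim n at_infinity (at q)"
begin

lemma nq: "n q = p" using mp nm by metis

text \<open>The source of most converses below: a one-sided transfer statement for \<open>m\<close>
  is applied to \<open>n\<close>.\<close>

lemma rev: "punctured_conformal n m q p"
  by standard (simp_all add: nq differentiable_m differentiable_n m_pole n_pole)

lemma inj_m: "inj m" by (metis injI nm)

lemma m_eq_q_iff [simp]: "m z = q \<longleftrightarrow> z = p" "q = m z \<longleftrightarrow> z = p"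
  using mp nm by metis+

lemma n_eq_p_iff [simp]: "n w = p \<longleftrightarrow> w = q" using nq mn by metis

lemma m_derivative: "z \<noteq> p \<Longrightarrow> (m has_field_derivative deriv m z) (at z)"
  using differentiable_m by (simp add: field_differentiable_derivI)

lemma m_isCont: "z \<noteq> p \<Longrightarrow> isCont m z"
  using differentiable_m by (simp add: field_differentiable_imp_continuous_at)

lemma n_isCont: "w \<noteq> q \<Longrightarrow> isCont n w"
  using differentiable_n by (simp add: field_differentiable_imp_continuous_at)

lemma m_large: "eventually (\<lambda>z. B < norm (m z)) (at p)"
proof -
  have "eventually (\<lambda>w::complex. B < norm w) at_infinity"
    unfolding eventually_at_infinity by (intro exI[of _ "B + 1"]) auto
  then show ?thesis
    using m_pole by (rule eventually_compose_filterlim)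
qed

lemma m_continuous_on: "p \<notin> S \<Longrightarrow> continuous_on S m"
  using m_isCont by (intro continuous_at_imp_continuous_on ballI) metis

lemma n_continuous_on: "q \<notin> S \<Longrightarrow> continuous_on S n"
  using n_isCont by (intro continuous_at_imp_continuous_on ballI) metis

lemma deriv_inverse:
  assumes "z \<noteq> p"
  shows "deriv n (m z) * deriv m z = 1"
proof -
  have "((n \<circ> m) has_field_derivative deriv n (m z) * deriv m z) (at z)"
    using assms by (intro DERIV_chain m_derivative punctured_conformal.m_derivative[OF rev]) auto
  moreover have "n \<circ> m = (\<lambda>z. z)" by auto
  ultimately have "((\<lambda>z. z) has_field_derivative deriv n (m z) * deriv m z) (at z)"
    by (simp only:)
  then show ?thesis using DERIV_ident by (rule DERIV_unique)
qed

lemma deriv_nonzero: "z \<noteq> p \<Longrightarrow> deriv m z \<noteq> 0"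
  using deriv_inverse by fastforce

section \<open>Frontiers, approach directions and tangents under a conformal map\<close>

lemma closure_transfer:
  assumes "z \<noteq> p" "z \<in> closure A" "\<And>x. x \<in> A \<Longrightarrow> x \<noteq> p \<Longrightarrow> m x \<in> B"
  shows "m z \<in> closure B"
proof (rule ccontr)
  assume "m z \<notin> closure B"
  moreover have "open (- closure B)" by (rule open_Compl) (rule closed_closure)
  moreover have "continuous_on (- {p}) m" by (rule m_continuous_on) simp
  ultimately have "open (- {p} \<inter> m -` (- closure B))" "z \<in> - {p} \<inter> m -` (- closure B)"
    using assms(1) by (auto intro!: continuous_open_preimage)
  then obtain x where "x \<in> A" "x \<noteq> p" "m x \<notin> closure B"
    using assms(2) open_Int_closure_eq_empty[of "- {p} \<inter> m -` (- closure B)" A] by blast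
  then show False using assms(3) closure_subset by blast
qed

text \<open>Being a frontier point is a local property, so membership at the distant point
  \<open>p\<close> may be left open. This freedom matters because \<open>transfer\<close> below
  treats \<open>q\<close>, the value of \<open>m\<close> at \<open>p\<close>, separately.\<close>

lemma frontier_transfer:
  assumes "z \<noteq> p" "\<And>x. x \<noteq> p \<Longrightarrow> m x \<in> R' \<longleftrightarrow> x \<in> R"
  shows "m z \<in> frontier R' \<longleftrightarrow> z \<in> frontier R"
proof
  show "m z \<in> frontier R'" if "z \<in> frontier R"
    using that assms closure_transfer[OF assms(1), of R R'] closure_transfer[OF assms(1), of "- R" "- R'"]
    by (auto simp: frontier_closures)
  have n: "n w \<in> R \<longleftrightarrow> w \<in> R'" if "w \<noteq> q" for w
    using assms(2)[of "n w"] that by simp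
  have "m z \<noteq> q" using assms(1) by simp
  note tr = punctured_conformal.closure_transfer[OF rev this]
  show "z \<in> frontier R" if "m z \<in> frontier R'"
    using that n tr[of R' R] tr[of "- R'" "- R"] by (auto simp: frontier_closures)
qed

lemma approach_directions_transfer_le:
  assumes "z \<noteq> p" "\<And>x. x \<noteq> p \<Longrightarrow> x \<in> R \<Longrightarrow> m x \<in> R'" "d \<in> approach_directions R z"
  shows "deriv m z * d \<in> approach_directions R' (m z)"
proof -
  obtain g where g: "g 0 = z" "\<And>t. 0 < t \<Longrightarrow> g t \<in> R" "(g has_vector_derivative d) (at 0 within {0..})"
    using assms(3) unfolding approach_directions_def by blast
  have "(g \<longlongrightarrow> z) (at 0 within {0..})"
    using has_vector_derivative_continuous[OF g(3)] g(1) by (simp add: continuous_within)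
  then have "eventually (\<lambda>t. g t \<noteq> p) (at 0 within {0..})"
    using assms(1) by (rule tendsto_imp_eventually_ne)
  then obtain e where e: "0 < e" "\<And>t. 0 < t \<Longrightarrow> t < e \<Longrightarrow> g t \<noteq> p"
    by (auto simp: eventually_at dist_real_def)
  \<comment> \<open>Only the germ at 0 matters for the derivative, but the whole curve must lie in
    the region. Since \<open>g\<close> may run through \<open>p\<close> later on, it is frozen at
    time \<open>e / 2\<close>.\<close>
  define h where "h t = g (min t (e / 2))" for t
  have "(h has_vector_derivative d) (at 0 within {0..})"
  proof (rule has_vector_derivative_transform_within[OF g(3), of "e / 2"])
    show "g t = h t" if "t \<in> {0..}" "dist t 0 < e / 2" for t
      using that by (simp add: h_def min_def)
  qed (use e in auto)
  moreover have "h 0 = z" using e g by (simp add: h_def)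
  ultimately have "((m \<circ> h) has_vector_derivative d * deriv m z) (at 0 within {0..})"
    using m_derivative[OF assms(1)]
    by (intro field_vector_diff_chain_within) (auto intro: has_field_derivative_at_within)
  moreover have "(m \<circ> h) t \<in> R'" if "0 < t" for t
  proof -
    have "0 < min t (e / 2)" "min t (e / 2) < e" using that e(1) by auto
    then have "g (min t (e / 2)) \<noteq> p" "g (min t (e / 2)) \<in> R" using e(2) g(2) by blast+
    then show ?thesis by (simp add: h_def assms(2))
  qed
  ultimately show ?thesis
    unfolding approach_directions_def
    using \<open>h 0 = z\<close> by (auto intro!: exI[of _ "m \<circ> h"] simp: mult.commute)
qed

lemma approach_directions_transfer:
  assumes "z \<noteq> p" "\<And>x. x \<noteq> p \<Longrightarrow> m x \<in> R' \<longleftrightarrow> x \<in> R"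
  shows "deriv m z * d \<in> approach_directions R' (m z) \<longleftrightarrow> d \<in> approach_directions R z"
proof
  assume l: "deriv m z * d \<in> approach_directions R' (m z)"
  have "deriv n (m z) * (deriv m z * d) \<in> approach_directions R (n (m z))"
    using assms by (intro punctured_conformal.approach_directions_transfer_le[OF rev _ _ l])
      (use assms(2)[of "n w" for w] in auto)
  then show "d \<in> approach_directions R z"
    using deriv_inverse[OF assms(1)] by (simp flip: mult.assoc)
next
  show "deriv m z * d \<in> approach_directions R' (m z)" if "d \<in> approach_directions R z"
    using assms that by (intro approach_directions_transfer_le[of z R R']) auto
qed

lemma tangent_vectors_transfer:
  assumes "v \<in> tangent_vectors K x" "proj x \<noteq> p"
  obtains v' where "v' \<in> tangent_vectors (lift m ` K) (lift m x)" "proj v' = deriv m (proj x) * proj v"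
proof
  \<comment> \<open>The derivative of the lifted map along \<open>v\<close>: complex multiplication
    in the plane, the vertical component unchanged.\<close>
  let ?v' = "space_point (proj v * deriv m (proj x), v $ 3)"
  show "proj ?v' = deriv m (proj x) * proj v" by (simp add: mult.commute)
  obtain g where g: "v \<noteq> 0" "g 0 = x" "range g \<subseteq> K" "(g has_vector_derivative v) (at 0)"
    using assms(1) by (auto simp: tangent_vectors_def)
  have "((\<lambda>t. proj (g t)) has_vector_derivative proj v) (at 0)"
    using bounded_linear.has_vector_derivative[OF bounded_linear_proj g(4)] .
  then have "((m \<circ> (\<lambda>t. proj (g t))) has_vector_derivative proj v * deriv m (proj x)) (at 0)"
    using m_derivative[OF assms(2)] g(2) by (intro field_vector_diff_chain_at) auto
  moreover have "((\<lambda>t. g t $ 3) has_vector_derivative v $ 3) (at 0)"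
    using bounded_linear.has_vector_derivative[OF bounded_linear_vec_nth g(4)] .
  ultimately have "((\<lambda>t. ((m \<circ> (\<lambda>t. proj (g t))) t, g t $ 3)) has_vector_derivative
      (proj v * deriv m (proj x), v $ 3)) (at 0)"
    by (rule has_vector_derivative_Pair)
  from bounded_linear.has_vector_derivative[OF bounded_linear_space_point this]
  have "((\<lambda>t. lift m (g t)) has_vector_derivative ?v') (at 0)"
    by (simp add: lift_def)
  moreover have "?v' \<noteq> 0"
  proof
    assume "?v' = 0"
    then have "proj ?v' = 0" "?v' $ 3 = 0" by (simp_all only: proj_0 zero_index)
    then have "proj v = proj 0" "v $ 3 = 0 $ 3"
      using deriv_nonzero[OF assms(2)] by simp_all
    with g(1) show False using real3_eqI by blast
  qed
  ultimately show "?v' \<in> tangent_vectors (lift m ` K) (lift m x)"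
    using g unfolding tangent_vectors_def by (auto intro!: exI[of _ "\<lambda>t. lift m (g t)"])
qed

lemma lift_n_lift_m [simp]: "lift n (lift m x) = x"
  by (rule lift_lift) simp

lemma image_lift_n_lift_m [simp]: "lift n ` lift m ` K = K"
  by (simp add: image_image)

section \<open>The diagram of the lifted link\<close>

lemma universe_lift: "universe (diagram_of (lift m ` K)) = m ` universe (diagram_of K)"
  by (auto simp: diagram_of_def image_iff)

lemma crossings_lift: "crossings (diagram_of (lift m ` K)) = m ` crossings (diagram_of K)"
proof -
  have le: "m ` crossings (diagram_of K) \<subseteq> crossings (diagram_of (lift m ` K))"
    if "punctured_conformal m n p q" for m n p q K
  proof -
    interpret punctured_conformal m n p q by fact
    show ?thesis
      by (auto simp: diagram_of_def) (metis lift_n_lift_m proj_lift)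
  qed
  have "n ` crossings (diagram_of (lift m ` K)) \<subseteq> crossings (diagram_of K)"
    using le[OF rev, of "lift m ` K"] by simp
  then have "m ` n ` crossings (diagram_of (lift m ` K)) \<subseteq> m ` crossings (diagram_of K)"
    by (rule image_mono)
  then have "crossings (diagram_of (lift m ` K)) \<subseteq> m ` crossings (diagram_of K)"
    by (simp add: image_image)
  with le[OF punctured_conformal_axioms] show ?thesis by blast
qed

lemma tangents_lift_le:
  assumes "c \<noteq> p"
  shows "w \<in> over_tangents (diagram_of K) c \<Longrightarrow>
      deriv m c * w \<in> over_tangents (diagram_of (lift m ` K)) (m c)"
    and "w \<in> under_tangents (diagram_of K) c \<Longrightarrow>
      deriv m c * w \<in> under_tangents (diagram_of (lift m ` K)) (m c)"
proof -
  have *: "\<exists>v' x' y'. deriv m c * proj v = proj v' \<and> x' \<in> lift m ` K \<and> y' \<in> lift m ` K \<and>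
      proj x' = m c \<and> proj y' = m c \<and> x' $ 3 = x $ 3 \<and> y' $ 3 = y $ 3 \<and>
      v' \<in> tangent_vectors (lift m ` K) x'"
    if xy: "x \<in> K" "y \<in> K" "proj x = c" "proj y = c" "v \<in> tangent_vectors K x" for v x y
  proof -
    obtain v' where "v' \<in> tangent_vectors (lift m ` K) (lift m x)" "proj v' = deriv m c * proj v"
      using tangent_vectors_transfer[OF xy(5)] xy(3) assms by metis
    with xy show ?thesis
      by (intro exI[of _ v'] exI[of _ "lift m x"] exI[of _ "lift m y"]) auto
  qed
  show "deriv m c * w \<in> over_tangents (diagram_of (lift m ` K)) (m c)"
    if w: "w \<in> over_tangents (diagram_of K) c"
  proof -
    obtain v x y where "w = proj v" "x \<in> K" "y \<in> K" "proj x = c" "proj y = c"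
      "y $ 3 < x $ 3" "v \<in> tangent_vectors K x"
      using w by (auto simp: diagram_of_def)
    with *[of x y v] show ?thesis by (fastforce simp: diagram_of_def)
  qed
  show "deriv m c * w \<in> under_tangents (diagram_of (lift m ` K)) (m c)"
    if w: "w \<in> under_tangents (diagram_of K) c"
  proof -
    obtain v x y where "w = proj v" "x \<in> K" "y \<in> K" "proj x = c" "proj y = c"
      "x $ 3 < y $ 3" "v \<in> tangent_vectors K x"
      using w by (auto simp: diagram_of_def)
    with *[of x y v] show ?thesis by (fastforce simp: diagram_of_def)
  qed
qed

lemma tangents_lift:
  assumes "c \<noteq> p"
  shows "over_tangents (diagram_of (lift m ` K)) (m c) = (*) (deriv m c) ` over_tangents (diagram_of K) c"
    and "under_tangents (diagram_of (lift m ` K)) (m c) = (*) (deriv m c) ` under_tangents (diagram_of K) c"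
proof -
  have eq: "w = deriv m c * (deriv n (m c) * w)" for w
    using deriv_inverse[OF assms] by (simp add: mult.commute mult.left_commute flip: mult.assoc)
  have mc: "m c \<noteq> q" using assms by simp
  note r = punctured_conformal.tangents_lift_le[OF rev mc, of _ "lift m ` K", simplified]
  show "over_tangents (diagram_of (lift m ` K)) (m c) = (*) (deriv m c) ` over_tangents (diagram_of K) c"
    using tangents_lift_le(1)[OF assms] r(1) by (blast intro: image_eqI[where f="(*) (deriv m c)", OF eq])
  show "under_tangents (diagram_of (lift m ` K)) (m c) = (*) (deriv m c) ` under_tangents (diagram_of K) c"
    using tangents_lift_le(2)[OF assms] r(2) by (blast intro: image_eqI[where f="(*) (deriv m c)", OF eq])
qed

lemma edges_lift:
  assumes "p \<notin> universe (diagram_of K)"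
  shows "edges (diagram_of (lift m ` K)) = (`) m ` edges (diagram_of K)"
proof -
  let ?S = "universe (diagram_of K) - crossings (diagram_of K)"
  have "p \<notin> ?S" "q \<notin> m ` ?S"
    using assms by auto
  then have "homeomorphism ?S (m ` ?S) m n"
    using m_continuous_on n_continuous_on by (auto simp: homeomorphism_def image_image)
  moreover have "m ` ?S = universe (diagram_of (lift m ` K)) - crossings (diagram_of (lift m ` K))"
    by (simp add: universe_lift crossings_lift image_set_diff[OF inj_m])
  ultimately show ?thesis
    unfolding edges_def using image_components by metis
qed

text \<open>The image of a region under the extension of \<open>m\<close> to the sphere: \<open>q\<close> is the image of
  infinity.\<close>

definition transfer :: "complex set \<Rightarrow> complex set" where
  "transfer R = {w. w \<noteq> q \<and> n w \<in> R} \<union> (if bounded R then {} else {q})"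

lemma m_in_transfer_iff: "z \<noteq> p \<Longrightarrow> m z \<in> transfer R \<longleftrightarrow> z \<in> R"
  by (simp add: transfer_def)

lemma transfer_minus_q: "transfer R - {q} = m ` (R - {p})"
proof -
  have "w \<in> m ` (R - {p})" if "w \<noteq> q" "n w \<in> R" for w
    using that by (intro image_eqI[of _ _ "n w"]) auto
  then show ?thesis by (auto simp: transfer_def)
qed

text \<open>Disjoint nonempty open connected sets are the components of their union. All but one
  transferred region is the image of a region with \<open>p\<close> deleted; the point
  \<open>q\<close> needs care only in the one that comes from the unbounded region.\<close>

lemma regions_transfer:
  assumes "compact U" "p \<notin> U"
  shows "components (- m ` U) = transfer ` components (- U)"
proof (rule components_open_unique)
  have bU: "bounded (- (- U))" using assms(1) by (simp add: compact_imp_bounded)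
  have oU: "open (- U)" using assms(1) by (simp add: compact_imp_closed open_Compl)
  have uniq: "R = S" if "R \<in> components (- U)" "S \<in> components (- U)" "\<not> bounded R" "\<not> bounded S" for R S
    using cobounded_unique_unbounded_components[OF bU] that by auto
  have unb: "\<exists>R \<in> components (- U). \<not> bounded R"
    using cobounded_unbounded_components[OF bU] by blast
  obtain B where B: "\<And>z. z \<in> U \<Longrightarrow> norm z \<le> B"
    using assms(1) by (meson bounded_iff compact_imp_bounded)
  \<comment> \<open>The outside of a large disc is connected, so it lies in the unbounded region:
    that region is a full neighbourhood of infinity.\<close>
  have far: "z \<in> R" if R: "R \<in> components (- U)" "\<not> bounded R" and z: "B < norm z" for z R
  proof -
    have "connected (- cball 0 B :: complex set)"
      by (intro connected_complement_bounded_convex) auto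
    moreover obtain y where "y \<in> R" "B < norm y"
      using R(2) by (meson bounded_iff linorder_not_le)
    moreover have "- cball 0 B \<subseteq> - U"
      using B by (auto simp: dist_norm)
    ultimately have "- cball 0 B \<subseteq> R"
      using R(1) by (intro components_maximal[of R "- U"]) auto
    with z show ?thesis by auto
  qed
  show "pairwise disjnt (transfer ` components (- U))"
  proof (rule pairwise_imageI)
    fix R S assume RS: "R \<in> components (- U)" "S \<in> components (- U)" "R \<noteq> S"
    then have "R \<inter> S = {}" by (metis components_nonoverlap)
    \<comment> \<open>There is only one unbounded region, so \<open>q\<close> is adjoined only
      once.\<close>
    moreover have "bounded R \<or> bounded S" using uniq RS by blast
    ultimately show "disjnt (transfer R) (transfer S)"
      by (auto simp: transfer_def disjnt_def)
  qed
  show "\<Union> (transfer ` components (- U)) = - m ` U"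
  proof (intro subset_antisym subsetI)
    fix w assume "w \<in> \<Union> (transfer ` components (- U))"
    then obtain R where "R \<in> components (- U)" "w \<in> transfer R" by blast
    then show "w \<in> - m ` U"
      using in_components_subset[of R "- U"] assms(2) by (auto simp: transfer_def split: if_splits)
  next
    fix w assume w: "w \<in> - m ` U"
    show "w \<in> \<Union> (transfer ` components (- U))"
    proof (cases "w = q")
      case True
      with unb show ?thesis by (auto simp: transfer_def)
    next
      case False
      have "n w \<in> - U" using w by (metis ComplD ComplI imageI mn)
      then obtain R where "R \<in> components (- U)" "n w \<in> R"
        using Union_components[of "- U"] by blast
      with False show ?thesis by (auto simp: transfer_def)
    qed
  qed
  fix X assume "X \<in> transfer ` components (- U)"
  then obtain R where R: "R \<in> components (- U)" "X = transfer R" by blast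
  have oR: "open R" and cR: "connected R" and nR: "R \<noteq> {}"
    using R(1) oU open_components in_components_connected in_components_nonempty by blast+
  \<comment> \<open>If \<open>p\<close> lies in \<open>R\<close>, it has gone to infinity. An open
    connected subset of the plane stays connected when a point is deleted.\<close>
  have conn: "connected (m ` (R - {p}))"
    using oR cR by (intro connected_continuous_image m_continuous_on connected_open_delete) auto
  have "R \<noteq> {p}" using oR not_open_singleton by blast
  then have ne: "R - {p} \<noteq> {}" using nR by blast
  have pre: "open {w. w \<noteq> q \<and> n w \<in> R}"
  proof -
    have "open (- {q} \<inter> n -` R)"
      using oR by (intro continuous_open_preimage n_continuous_on) auto
    moreover have "- {q} \<inter> n -` R = {w. w \<noteq> q \<and> n w \<in> R}" by auto
    ultimately show ?thesis by simp
  qed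
  show "open X \<and> connected X \<and> X \<noteq> {}"
  proof (cases "bounded R")
    case True
    then have "X = {w. w \<noteq> q \<and> n w \<in> R}" by (simp add: R transfer_def)
    moreover have "X = m ` (R - {p})"
      using True transfer_minus_q[of R] by (auto simp: R transfer_def)
    ultimately show ?thesis using pre conn ne by (metis image_is_empty)
  next
    case False
    then have X: "X = insert q {w. w \<noteq> q \<and> n w \<in> R}" by (auto simp: R transfer_def)
    have X': "X = insert q (m ` (R - {p}))"
      using X transfer_minus_q[of R] False by (auto simp: transfer_def)
    \<comment> \<open>Near \<open>q\<close> the values of \<open>n\<close> have norm above
      \<open>B\<close> and hence lie in \<open>R\<close> by \<open>far\<close>; this makes
      \<open>q\<close> an interior point of \<open>X\<close>.\<close>
    have "eventually (\<lambda>w. B < norm (n w)) (at q)"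
      by (rule punctured_conformal.m_large[OF rev])
    then have "eventually (\<lambda>w. w \<in> X) (at q)"
      by (rule eventually_mono) (use far[OF R(1) False] X in auto)
    then have "eventually (\<lambda>w. w \<in> X) (nhds q)"
      using X by (simp add: eventually_nhds_conv_at)
    then obtain T where "open T" "q \<in> T" "T \<subseteq> X"
      by (auto simp: eventually_nhds)
    then have "X = T \<union> {w. w \<noteq> q \<and> n w \<in> R}" using X by auto
    then have "open X" using pre \<open>open T\<close> by auto
    moreover have "q \<in> closure (m ` (R - {p}))"
    proof -
      have "q islimpt X"
        using \<open>open X\<close> X by (intro interior_limit_point) (auto simp: interior_open)
      then have "q islimpt (X - {q})" by (simp add: islimpt_def) blast
      then have "q islimpt m ` (R - {p})" using X' by (auto elim: islimpt_subset)
      then show ?thesis by (simp add: closure_def)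
    qed
    \<comment> \<open>\<open>X\<close> lies between a connected set and its closure.\<close>
    then have "connected X"
      using X' conn by (intro connected_intermediate_closure[OF conn])
        (auto intro: closure_subset[THEN subsetD])
    ultimately show ?thesis using X by blast
  qed
qed

text \<open>A region is open, so it has a point other than \<open>p\<close>, and the image of that
  point tells the regions apart.\<close>

lemma inj_on_transfer:
  assumes "compact U"
  shows "inj_on transfer (components (- U))"
proof (rule inj_onI)
  fix R S assume RS: "R \<in> components (- U)" "S \<in> components (- U)" "transfer R = transfer S"
  have "open R"
    using open_components[OF _ RS(1)] assms by (simp add: compact_imp_closed open_Compl)
  then have "R \<noteq> {p}" using not_open_singleton by metis
  moreover have "R \<noteq> {}" using RS(1) by (rule in_components_nonempty)
  ultimately obtain z where "z \<in> R" "z \<noteq> p" by blast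
  then have "z \<in> S"
    using RS(3) m_in_transfer_iff by blast
  with \<open>z \<in> R\<close> RS show "R = S" by (metis components_nonoverlap disjoint_iff)
qed

lemma transfer_unbounded:
  assumes "open R" "p \<in> R"
  shows "\<not> bounded (transfer R)"
proof
  assume "bounded (transfer R)"
  then obtain B where B: "\<And>w. w \<in> transfer R \<Longrightarrow> norm w \<le> B" by (meson bounded_iff)
  have "eventually (\<lambda>z. B < norm (m z)) (at p)"
    by (rule m_large)
  moreover have "eventually (\<lambda>z. z \<in> R \<and> z \<noteq> p) (at p)"
    using assms by (auto simp: eventually_at_topological)
  ultimately have "eventually (\<lambda>z. B < norm (m z) \<and> z \<in> R \<and> z \<noteq> p) (at p)"
    by (rule eventually_conj)
  then obtain z where "B < norm (m z)" "z \<in> R" "z \<noteq> p"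
    using eventually_happens'[OF at_neq_bot] by blast
  then show False using B m_in_transfer_iff linorder_not_le by blast
qed

end

section \<open>Goeritz matrices of isomorphic shaded diagrams\<close>

text \<open>Purely combinatorial: the matrix entries and the connectivity of the shaded graph depend
  only on the incidences of crossings with regions and on the indices. Corresponding enumerations of
  the unshaded regions give literally the same matrix.\<close>

lemma adjusted_goeritz_isomorphic:
  assumes inj_\<Phi>: "inj_on \<Phi> (regions D)" and regions: "regions D' = \<Phi> ` regions D"
    and \<sigma>: "\<sigma> \<subseteq> regions D"
    and inj_m: "inj_on m (crossings D)" and crossings: "crossings D' = m ` crossings D"
    and frontier: "\<And>c R. c \<in> crossings D \<Longrightarrow> R \<in> regions D \<Longrightarrow> m c \<in> frontier (\<Phi> R) \<longleftrightarrow> c \<in> frontier R"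
    and index: "\<And>c. c \<in> crossings D \<Longrightarrow> goeritz_index D' (\<Phi> ` \<sigma>) (m c) = goeritz_index D \<sigma> c"
  shows "adjusted_goeritz D' (\<Phi> ` \<sigma>) = adjusted_goeritz D \<sigma>"
proof -
  have inc: "incident_crossings D' (\<Phi> R) (\<Phi> S) = m ` incident_crossings D R S"
    if "R \<in> regions D" "S \<in> regions D" for R S
    unfolding incident_crossings_def crossings using frontier that by blast
  have mat: "goeritz_matrix D' (\<Phi> ` \<sigma>) (map \<Phi> Rs) = goeritz_matrix D \<sigma> Rs"
    if Rs: "set Rs \<subseteq> regions D" for Rs
  proof -
    define g where "g i j = - (\<Sum>c\<in>incident_crossings D (Rs ! i) (Rs ! j). goeritz_index D \<sigma> c)" for i j
    define g' where "g' i j = - (\<Sum>c\<in>incident_crossings D' (map \<Phi> Rs ! i) (map \<Phi> Rs ! j).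
        goeritz_index D' (\<Phi> ` \<sigma>) c)" for i j
    have eq: "g' i j = g i j" if "i < length Rs" "j < length Rs" for i j
    proof -
      let ?I = "incident_crossings D (Rs ! i) (Rs ! j)"
      have sub: "?I \<subseteq> crossings D" by (auto simp: incident_crossings_def)
      have "g' i j = - (\<Sum>c\<in>m ` ?I. goeritz_index D' (\<Phi> ` \<sigma>) c)"
        using that Rs by (simp add: g'_def inc subset_iff)
      also have "\<dots> = - (\<Sum>c\<in>?I. goeritz_index D' (\<Phi> ` \<sigma>) (m c))"
        using sum.reindex[OF inj_on_subset[OF inj_m sub]] by (simp add: comp_def)
      also have "\<dots> = g i j"
        using sub index by (auto simp: g_def intro!: sum.cong)
      finally show ?thesis .
    qed
    have "Matrix.mat n n (\<lambda>(i, j). if i = j then - (\<Sum>k\<in>{..<n} - {i}. g' i k) else g' i j)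
        = Matrix.mat n n (\<lambda>(i, j). if i = j then - (\<Sum>k\<in>{..<n} - {i}. g i k) else g i j)"
      if "n = length Rs" for n
      using eq that by (intro eq_matI) (auto intro!: sum.cong)
    then show ?thesis
      unfolding goeritz_matrix_def Let_def length_map g_def g'_def by blast
  qed
  have inj_\<sigma>: "inj_on \<Phi> \<sigma>" using inj_\<Phi> \<sigma> by (rule inj_on_subset)
  let ?r = "shaded_adjacency D \<sigma>" and ?r' = "shaded_adjacency D' (\<Phi> ` \<sigma>)"
  have adj: "(\<Phi> R, \<Phi> S) \<in> ?r' \<longleftrightarrow> (R, S) \<in> ?r" if "R \<in> \<sigma>" "S \<in> \<sigma>" for R S
  proof -
    have "(\<exists>c\<in>crossings D'. c \<in> frontier (\<Phi> R) \<and> c \<in> frontier (\<Phi> S)) \<longleftrightarrow>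
        (\<exists>c\<in>crossings D. c \<in> frontier R \<and> c \<in> frontier S)"
      unfolding crossings using frontier \<sigma> that by blast
    with that show ?thesis by (simp add: shaded_adjacency_def)
  qed
  have r_sub: "?r \<subseteq> \<sigma> \<times> \<sigma>" "?r' \<subseteq> \<Phi> ` \<sigma> \<times> \<Phi> ` \<sigma>"
    by (auto simp: shaded_adjacency_def)
  have reach_to: "(\<Phi> R, \<Phi> S) \<in> ?r'\<^sup>*" if "(R, S) \<in> ?r\<^sup>*" for R S
    using that
  proof (induction rule: rtrancl_induct)
    case (step S T)
    then show ?case using adj r_sub(1) by (blast intro: rtrancl_into_rtrancl)
  qed simp
  \<comment> \<open>Each step of \<open>?r'\<close> ends at the image of a shaded region, so a path
    starting at \<open>\<Phi> R\<close> can be pulled back step by step.\<close>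
  have reach_from: "\<exists>S\<in>\<sigma>. X = \<Phi> S \<and> (R, S) \<in> ?r\<^sup>*" if "(\<Phi> R, X) \<in> ?r'\<^sup>*" "R \<in> \<sigma>" for R X
    using that(1)
  proof (induction rule: rtrancl_induct)
    case base
    then show ?case using that(2) by blast
  next
    case (step X Y)
    then obtain S where S: "S \<in> \<sigma>" "X = \<Phi> S" "(R, S) \<in> ?r\<^sup>*" by blast
    obtain T where T: "T \<in> \<sigma>" "Y = \<Phi> T" using step.hyps(2) r_sub(2) by blast
    with S step.hyps(2) adj have "(S, T) \<in> ?r" by blast
    with S(3) have "(R, T) \<in> ?r\<^sup>*" by (rule rtrancl_into_rtrancl)
    with T show ?case by blast
  qed
  let ?E = "?r\<^sup>* \<inter> \<sigma> \<times> \<sigma>" and ?E' = "?r'\<^sup>* \<inter> \<Phi> ` \<sigma> \<times> \<Phi> ` \<sigma>"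
  have class_eq: "?E' `` {\<Phi> R} = \<Phi> ` (?E `` {R})" if R: "R \<in> \<sigma>" for R
  proof (intro subset_antisym subsetI)
    fix X assume "X \<in> ?E' `` {\<Phi> R}"
    then have "(\<Phi> R, X) \<in> ?r'\<^sup>*" by simp
    then obtain S where "S \<in> \<sigma>" "X = \<Phi> S" "(R, S) \<in> ?r\<^sup>*"
      using reach_from[OF _ R] by metis
    moreover from this R have "S \<in> ?E `` {R}" by simp
    ultimately show "X \<in> \<Phi> ` (?E `` {R})" by blast
  next
    fix X assume "X \<in> \<Phi> ` (?E `` {R})"
    then obtain S where "S \<in> \<sigma>" "X = \<Phi> S" "(R, S) \<in> ?r\<^sup>*" by auto
    moreover from this(3) have "(\<Phi> R, \<Phi> S) \<in> ?r'\<^sup>*" by (rule reach_to)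
    ultimately show "X \<in> ?E' `` {\<Phi> R}" using R by simp
  qed
  have "(\<Phi> ` \<sigma>) // ?E' = (`) \<Phi> ` (\<sigma> // ?E)"
  proof -
    have "(\<Phi> ` \<sigma>) // ?E' = (\<lambda>R. ?E' `` {\<Phi> R}) ` \<sigma>" by (auto simp: quotient_def)
    also have "\<dots> = (\<lambda>R. \<Phi> ` (?E `` {R})) ` \<sigma>" by (intro image_cong refl class_eq)
    also have "\<dots> = (`) \<Phi> ` (\<sigma> // ?E)" by (auto simp: quotient_def)
    finally show ?thesis .
  qed
  moreover have "inj_on ((`) \<Phi>) (\<sigma> // ?E)"
    using inj_\<sigma> by (intro inj_on_image inj_on_subset[OF inj_\<sigma>]) (auto simp: quotient_def)
  ultimately have beta: "beta_s D' (\<Phi> ` \<sigma>) = beta_s D \<sigma>"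
    unfolding beta_s_def by (simp add: card_image)
  have adjusted: "adjusted_goeritz_matrix D' (\<Phi> ` \<sigma>) (map \<Phi> Rs) = adjusted_goeritz_matrix D \<sigma> Rs"
    if "set Rs \<subseteq> regions D" for Rs
    using mat[OF that] by (simp add: adjusted_goeritz_matrix_def beta)
  have unshaded: "regions D' - \<Phi> ` \<sigma> = \<Phi> ` (regions D - \<sigma>)"
    unfolding regions using inj_on_image_set_diff[OF inj_\<Phi> _ \<sigma>, of "regions D"] by auto
  show ?thesis
  proof (intro subset_antisym subsetI)
    fix B assume "B \<in> adjusted_goeritz D \<sigma>"
    then obtain Rs where Rs: "distinct Rs" "set Rs = regions D - \<sigma>"
      "permutation_equivalent (adjusted_goeritz_matrix D \<sigma> Rs) B"
      by (auto simp: adjusted_goeritz_def)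
    have "distinct (map \<Phi> Rs)" "set (map \<Phi> Rs) = regions D' - \<Phi> ` \<sigma>"
      using Rs(1,2) inj_on_subset[OF inj_\<Phi>, of "set Rs"] unshaded by (auto simp: distinct_map)
    moreover have "permutation_equivalent (adjusted_goeritz_matrix D' (\<Phi> ` \<sigma>) (map \<Phi> Rs)) B"
      using Rs adjusted[of Rs] by auto
    ultimately show "B \<in> adjusted_goeritz D' (\<Phi> ` \<sigma>)"
      unfolding adjusted_goeritz_def by blast
  next
    fix B assume "B \<in> adjusted_goeritz D' (\<Phi> ` \<sigma>)"
    then obtain Rs' where Rs': "distinct Rs'" "set Rs' = regions D' - \<Phi> ` \<sigma>"
      "permutation_equivalent (adjusted_goeritz_matrix D' (\<Phi> ` \<sigma>) Rs') B"
      by (auto simp: adjusted_goeritz_def)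
    \<comment> \<open>The enumeration is pulled back along \<open>\<Phi>\<close>, which is injective
      on regions; mapping it forward again returns \<open>Rs'\<close>.\<close>
    define Rs where "Rs = map (inv_into (regions D) \<Phi>) Rs'"
    have Rs'_sub: "set Rs' \<subseteq> \<Phi> ` regions D" using Rs'(2) unshaded by auto
    have "map \<Phi> Rs = Rs'"
      unfolding Rs_def using Rs'_sub by (auto simp: f_inv_into_f subset_iff intro!: map_idI)
    moreover have "set Rs = regions D - \<sigma>"
    proof -
      have "set Rs = inv_into (regions D) \<Phi> ` \<Phi> ` (regions D - \<sigma>)"
        by (simp add: Rs_def Rs'(2) unshaded)
      also have "\<dots> = regions D - \<sigma>"
        using inj_\<Phi> by (intro inv_into_image_cancel) auto
      finally show ?thesis .
    qed
    moreover have "distinct Rs"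
      using calculation(1) Rs'(1) distinct_map by metis
    ultimately show "B \<in> adjusted_goeritz D \<sigma>"
      unfolding adjusted_goeritz_def using Rs'(3) adjusted[of Rs] by auto
  qed
qed

section \<open>Transfer of diagrams\<close>

text \<open>A nonzero complex factor turns and scales the plane, so the inner product is multiplied
  by the positive number \<open>(norm a)\<^sup>2\<close>. An orientation-reversing map would
  exchange right and left here and negate the Goeritz indices.\<close>

lemma to_the_right_mult: "a \<noteq> 0 \<Longrightarrow> to_the_right (a * f) (a * w) \<longleftrightarrow> to_the_right f w"
proof -
  assume "a \<noteq> 0"
  have "(a * w) \<bullet> (- \<i> * (a * f)) = (norm a)\<^sup>2 * (w \<bullet> (- \<i> * f))"
    unfolding cmod_power2 inner_complex_def by (simp add: power2_eq_square algebra_simps)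
  with \<open>a \<noteq> 0\<close> show ?thesis
    by (simp add: to_the_right_def mult_less_0_iff)
qed

lemma smooth_immersion_on_cong:
  "(\<And>x. x \<in> S \<Longrightarrow> f x = g x) \<Longrightarrow> smooth_immersion_on S f \<longleftrightarrow> smooth_immersion_on S g"
  unfolding smooth_immersion_on_def by simp

text \<open>For curves that agree only on the unit interval. The projected image of a link component
  is such a case: the diffeomorphism of space agrees with the lift on the link alone.\<close>

lemma piecewise_smooth_curve_cong:
  assumes eq: "\<And>t. t \<in> {0..1} \<Longrightarrow> \<gamma> t = \<delta> t" and "piecewise_smooth_curve \<gamma>"
  shows "piecewise_smooth_curve \<delta>"
proof -
  obtain T where T: "finite T" "{0, 1} \<subseteq> T" "T \<subseteq> {0..1}"
    and imm: "\<And>a b. a \<in> T \<Longrightarrow> b \<in> T \<Longrightarrow> a < b \<and> {a<..<b} \<inter> T = {} \<Longrightarrow> smooth_immersion_on {a..b} \<gamma>"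
    and "path \<gamma>"
    using assms(2) unfolding piecewise_smooth_curve_def by metis
  have "smooth_immersion_on {a..b} \<delta>" if ab: "a \<in> T" "b \<in> T" "a < b \<and> {a<..<b} \<inter> T = {}" for a b
  proof -
    have "{a..b} \<subseteq> {0..1}" using T(3) ab by auto
    then have "smooth_immersion_on {a..b} \<gamma> \<longleftrightarrow> smooth_immersion_on {a..b} \<delta>"
      using eq by (intro smooth_immersion_on_cong) auto
    with imm[OF ab] show ?thesis by simp
  qed
  moreover have "path \<delta>"
    using \<open>path \<gamma>\<close> eq continuous_on_cong[of "{0..1}" "{0..1}" \<gamma> \<delta>] by (simp add: path_def)
  ultimately show ?thesis
    unfolding piecewise_smooth_curve_def using T by blast
qed

section \<open>Compactness of links and existence of edges\<close>

lemma link_compact: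
  assumes "parametrizes_link \<Gamma> K"
  shows "compact K"
  using assms unfolding parametrizes_link_def
  by (auto intro!: compact_UN compact_path_image simp: simple_path_imp_path)

lemma link_infinite:
  assumes "parametrizes_link \<Gamma> K"
  shows "infinite K"
proof
  assume "finite K"
  obtain \<gamma> where \<gamma>: "\<gamma> \<in> \<Gamma>" "simple_path \<gamma>"
    using assms unfolding parametrizes_link_def by blast
  have "path_image \<gamma> \<subseteq> K"
    using assms \<gamma>(1) unfolding parametrizes_link_def by blast
  then have "finite (\<gamma> ` {0<..<1})"
    using \<open>finite K\<close> by (rule_tac finite_subset[of _ K]) (auto simp: path_image_def)
  moreover have "inj_on \<gamma> {0<..<1}"
    using \<gamma>(2) by (force simp: simple_path_def loop_free_def inj_on_def)
  ultimately have "finite {0<..<1::real}" by (rule finite_imageD)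
  then show False by (simp add: infinite_Ioo)
qed

lemma compact_universe:
  assumes "regular_projection K"
  shows "compact (universe (diagram_of K))"
proof -
  have "compact K" using assms link_compact unfolding regular_projection_def by blast
  then have "compact (proj ` K)"
    by (intro compact_continuous_image linear_continuous_on bounded_linear_proj)
  then show ?thesis by (simp add: diagram_of_def)
qed

text \<open>A link is infinite, whereas finitely many crossings with two preimages each account for
  finitely many of its points. An edge in turn forces every shading to have regions of both
  shades.\<close>

lemma edges_nonempty:
  assumes "regular_projection K"
  shows "edges (diagram_of K) \<noteq> {}"
proof
  assume "edges (diagram_of K) = {}"
  then have "universe (diagram_of K) \<subseteq> crossings (diagram_of K)"
    by (simp add: edges_def components_eq_empty)
  moreover have "proj x \<in> universe (diagram_of K)" if "x \<in> K" for x
    using that by (simp add: diagram_of_def)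
  ultimately have "K = (\<Union>c\<in>crossings (diagram_of K). {x \<in> K. proj x = c})"
    by blast
  moreover have "finite {x \<in> K. proj x = c}" if "c \<in> crossings (diagram_of K)" for c
  proof -
    have "card {x \<in> K. proj x = c} = 2"
      using assms that unfolding regular_projection_def by blast
    then show ?thesis by (metis card.infinite zero_neq_numeral)
  qed
  moreover have "finite (crossings (diagram_of K))"
    using assms unfolding regular_projection_def by blast
  ultimately have "finite K" by (metis (no_types, lifting) finite_UN)
  moreover have "infinite K"
    using assms link_infinite unfolding regular_projection_def by blast
  ultimately show False by contradiction
qed

context punctured_conformal
begin

section \<open>Shadings and Goeritz data of the lifted diagram\<close>

lemma transfer_shading:
  assumes "compact (universe (diagram_of K))" "p \<notin> universe (diagram_of K)"
  shows "regions (diagram_of (lift m ` K)) = transfer ` regions (diagram_of K)"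
    and "inj_on transfer (regions (diagram_of K))"
    and "is_shading (diagram_of K) \<sigma> \<Longrightarrow> is_shading (diagram_of (lift m ` K)) (transfer ` \<sigma>)"
proof -
  show R: "regions (diagram_of (lift m ` K)) = transfer ` regions (diagram_of K)"
    using regions_transfer[OF assms] by (simp add: regions_def universe_lift)
  show inj: "inj_on transfer (regions (diagram_of K))"
    using inj_on_transfer[OF assms(1)] by (simp add: regions_def)
  assume sh: "is_shading (diagram_of K) \<sigma>"
  then have sub: "\<sigma> \<subseteq> regions (diagram_of K)" by (simp add: is_shading_def)
  then have diff: "regions (diagram_of (lift m ` K)) - transfer ` \<sigma> = transfer ` (regions (diagram_of K) - \<sigma>)"
    unfolding R using inj_on_image_set_diff[OF inj _ sub, of "regions (diagram_of K)"] by auto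
  have fr: "m ` e \<subseteq> frontier (transfer R)" if e: "e \<in> edges (diagram_of K)" and "e \<subseteq> frontier R" for e R
  proof -
    have "e \<subseteq> universe (diagram_of K)"
      using in_components_subset e unfolding edges_def by blast
    then have "m z \<in> frontier (transfer R)" if "z \<in> e" for z
      using that \<open>e \<subseteq> frontier R\<close> assms(2) frontier_transfer[of z "transfer R" R] m_in_transfer_iff by blast
    then show ?thesis by blast
  qed
  show "is_shading (diagram_of (lift m ` K)) (transfer ` \<sigma>)"
    unfolding is_shading_def
  proof (intro conjI ballI)
    show "transfer ` \<sigma> \<subseteq> regions (diagram_of (lift m ` K))" using R sub by blast
    fix e' assume "e' \<in> edges (diagram_of (lift m ` K))"
    then obtain e where e: "e \<in> edges (diagram_of K)" "e' = m ` e"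
      using edges_lift[OF assms(2)] by blast
    obtain R S where "R \<in> \<sigma>" "e \<subseteq> frontier R" "S \<in> regions (diagram_of K) - \<sigma>" "e \<subseteq> frontier S"
      using sh e(1) unfolding is_shading_def by meson
    then show "\<exists>R\<in>transfer ` \<sigma>. e' \<subseteq> frontier R"
      "\<exists>R\<in>regions (diagram_of (lift m ` K)) - transfer ` \<sigma>. e' \<subseteq> frontier R"
      unfolding diff e(2) using fr[OF e(1)] by blast+
  qed
qed

text \<open>The derivative of \<open>m\<close> at \<open>c\<close> is multiplication by
  \<open>deriv m c\<close>. It is additive, so together with the half-arcs \<open>u\<close> and
  \<open>v\<close> it carries the direction \<open>u + v\<close> of the observer's sector.\<close>

lemma goeritz_index_lift:
  assumes "compact (universe (diagram_of K))" "p \<notin> universe (diagram_of K)"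
    and "\<sigma> \<subseteq> regions (diagram_of K)" "c \<noteq> p"
  shows "goeritz_index (diagram_of (lift m ` K)) (transfer ` \<sigma>) (m c) = goeritz_index (diagram_of K) \<sigma> c"
proof -
  have diff: "regions (diagram_of (lift m ` K)) - transfer ` \<sigma> = transfer ` (regions (diagram_of K) - \<sigma>)"
    unfolding transfer_shading(1)[OF assms(1,2)]
    using inj_on_image_set_diff[OF transfer_shading(2)[OF assms(1,2)] _ assms(3)] by blast
  have "deriv m c * u + deriv m c * v \<in> approach_directions (transfer R) (m c) \<longleftrightarrow>
      u + v \<in> approach_directions R c" for u v R
    using approach_directions_transfer[OF assms(4) m_in_transfer_iff] by (simp flip: distrib_left)
  moreover have "to_the_right (- (deriv m c * u + deriv m c * v)) (deriv m c * u) \<longleftrightarrow>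
      to_the_right (- (u + v)) u" for u v
    using to_the_right_mult[OF deriv_nonzero[OF assms(4)], of "- (u + v)" u] by (simp add: algebra_simps)
  ultimately show ?thesis
    unfolding goeritz_index_def diff tangents_lift[OF assms(4)] by (simp only: bex_simps)
qed

lemma adjusted_goeritz_lift:
  assumes "compact (universe (diagram_of K))" "p \<notin> universe (diagram_of K)"
    and "\<sigma> \<subseteq> regions (diagram_of K)"
  shows "adjusted_goeritz (diagram_of (lift m ` K)) (transfer ` \<sigma>) = adjusted_goeritz (diagram_of K) \<sigma>"
proof (rule adjusted_goeritz_isomorphic)
  have "crossings (diagram_of K) \<subseteq> universe (diagram_of K)"
    by (auto simp: diagram_of_def)
  then have np: "c \<noteq> p" if "c \<in> crossings (diagram_of K)" for c
    using that assms(2) by blast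
  show "inj_on m (crossings (diagram_of K))"
    using inj_m by (rule inj_on_subset) simp
  show "crossings (diagram_of (lift m ` K)) = m ` crossings (diagram_of K)"
    by (rule crossings_lift)
  show "m c \<in> frontier (transfer R) \<longleftrightarrow> c \<in> frontier R" if "c \<in> crossings (diagram_of K)" for c R
    using np[OF that] m_in_transfer_iff by (rule frontier_transfer)
  show "goeritz_index (diagram_of (lift m ` K)) (transfer ` \<sigma>) (m c) = goeritz_index (diagram_of K) \<sigma> c"
    if "c \<in> crossings (diagram_of K)" for c
    using assms np[OF that] by (rule goeritz_index_lift)
qed (use transfer_shading[OF assms(1,2)] assms(3) in auto)

text \<open>\<open>lift m\<close> is singular over \<open>p\<close> and is no homeomorphism of
  space. The components of the link are therefore moved by \<open>f\<close>, which agrees with it on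
  \<open>K\<close>, while the projected curves are moved by \<open>m\<close>, smooth off
  \<open>p\<close>.\<close>

lemma regular_projection_lift:
  assumes "regular_projection K" "p \<notin> universe (diagram_of K)" "smooth_on (- {p}) m"
    and "ambient_diffeomorphism f" "\<And>x. x \<in> K \<Longrightarrow> f x = lift m x"
  shows "regular_projection (lift m ` K)"
proof -
  obtain \<Gamma> where \<Gamma>: "parametrizes_link \<Gamma> K" "\<And>\<gamma>. \<gamma> \<in> \<Gamma> \<Longrightarrow> piecewise_smooth_curve (proj \<circ> \<gamma>)"
    using assms(1) unfolding regular_projection_def by blast
  have fK: "f ` K = lift m ` K" using assms(5) by simp
  have "piecewise_smooth_curve (proj \<circ> (f \<circ> \<gamma>))" if "\<gamma> \<in> \<Gamma>" for \<gamma>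
  proof -
    have im: "path_image \<gamma> \<subseteq> K"
      using \<Gamma>(1) that unfolding parametrizes_link_def by blast
    have pim: "path_image (proj \<circ> \<gamma>) \<subseteq> - {p}"
      using im assms(2) by (auto simp: path_image_compose diagram_of_def)
    have "inj (frechet_derivative m (at z))" if "z \<noteq> p" for z
    proof (rule inj_frechet_derivative[where V=UNIV])
      show "(m has_derivative frechet_derivative m (at z)) (at z)"
        using assms(3) that by (auto intro: smooth_on_has_derivative)
      show "(n has_derivative (*) (deriv n (m z))) (at (m z))"
        using punctured_conformal.m_derivative[OF rev, of "m z"] that
        by (simp add: has_field_derivative_def)
    qed auto
    then have "inj (frechet_derivative m (at z))" if "z \<in> path_image (proj \<circ> \<gamma>)" for z
      using that pim by blast
    then have "piecewise_smooth_curve (m \<circ> (proj \<circ> \<gamma>))"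
      using pim assms(3)
      by (intro piecewise_smooth_curve_compose[OF \<Gamma>(2)[OF that], where V="- {p}"]) auto
    moreover have "(m \<circ> (proj \<circ> \<gamma>)) t = (proj \<circ> (f \<circ> \<gamma>)) t" if "t \<in> {0..1}" for t
    proof -
      have "\<gamma> t \<in> K" using im that by (auto simp: path_image_def)
      then show ?thesis by (simp add: assms(5))
    qed
    ultimately show ?thesis by (rule piecewise_smooth_curve_cong[rotated])
  qed
  moreover have "parametrizes_link ((\<circ>) f ` \<Gamma>) (lift m ` K)"
    using parametrizes_link_image[OF \<Gamma>(1) assms(4)] fK by simp
  moreover have "finite (crossings (diagram_of (lift m ` K)))"
    using assms(1) by (simp add: crossings_lift regular_projection_def)
  moreover have "card {x \<in> lift m ` K. proj x = m c} = 2"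
    and "\<exists>u\<in>over_tangents (diagram_of (lift m ` K)) (m c). \<exists>v\<in>under_tangents (diagram_of (lift m ` K)) (m c).
           Im (cnj u * v) \<noteq> 0" if c: "c \<in> crossings (diagram_of K)" for c
  proof -
    have "{x \<in> lift m ` K. proj x = m c} = lift m ` {x \<in> K. proj x = c}"
      by (auto simp: inj_eq[OF inj_m])
    moreover have "inj_on (lift m) {x \<in> K. proj x = c}"
      by (rule inj_on_inverseI[where g="lift n"]) simp
    moreover have "card {x \<in> K. proj x = c} = 2"
      using c assms(1) unfolding regular_projection_def by blast
    ultimately show "card {x \<in> lift m ` K. proj x = m c} = 2"
      by (simp add: card_image)
    have "c \<noteq> p" using c assms(2) by (auto simp: diagram_of_def)
    obtain u v where uv: "u \<in> over_tangents (diagram_of K) c" "v \<in> under_tangents (diagram_of K) c"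
      "Im (cnj u * v) \<noteq> 0"
      using c assms(1) unfolding regular_projection_def by blast
    \<comment> \<open>The determinant of two plane vectors is scaled by the squared modulus of
      \<open>a\<close>, so transversality survives.\<close>
    have "Im (cnj (a * u) * (a * v)) = (norm a)\<^sup>2 * Im (cnj u * v)" for a
      unfolding cmod_power2 by (simp add: power2_eq_square algebra_simps)
    then have "Im (cnj (deriv m c * u) * (deriv m c * v)) \<noteq> 0"
      using uv(3) deriv_nonzero[OF \<open>c \<noteq> p\<close>] by simp
    then show "\<exists>u\<in>over_tangents (diagram_of (lift m ` K)) (m c).
        \<exists>v\<in>under_tangents (diagram_of (lift m ` K)) (m c). Im (cnj u * v) \<noteq> 0"
      using tangents_lift_le[OF \<open>c \<noteq> p\<close>] uv(1,2) by blast
  qed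
  ultimately show ?thesis
    unfolding regular_projection_def crossings_lift by blast
qed

end

section \<open>Changing the unbounded region\<close>

lemma punctured_conformal_inversion:
  "punctured_conformal (\<lambda>z. inverse (z - p)) (\<lambda>w. inverse w + p) p 0"
proof
  show "(\<lambda>z. inverse (z - p)) field_differentiable (at z)" if "z \<noteq> p" for z
    using that unfolding field_differentiable_def by (auto intro!: exI derivative_eq_intros)
  show "(\<lambda>w. inverse w + p) field_differentiable (at w)" if "w \<noteq> 0" for w
    using that unfolding field_differentiable_def by (auto intro!: exI derivative_eq_intros)
  have "filterlim (\<lambda>z. z - p) (at 0) (at p)"
    by (auto simp: filterlim_at eventually_at_filter intro!: tendsto_eq_intros)
  then show "filterlim (\<lambda>z. inverse (z - p)) at_infinity (at p)"
    by (rule filterlim_compose[OF filterlim_inverse_at_infinity])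
  show "filterlim (\<lambda>w. inverse w + p) at_infinity (at 0)"
    using tendsto_add_filterlim_at_infinity'[OF filterlim_inverse_at_infinity tendsto_const] .
qed auto

lemma smooth_on_inversion: "smooth_on (- {p}) (\<lambda>z::complex. inverse (z - p))"
  by (rule smooth_on_compose[OF smooth_on_inverse[of "- {0}"]])
    (auto intro!: smooth_on_diff smooth_on_ident smooth_on_const)

text \<open>The half turn about the first coordinate axis. On the link the twist turns a horizontal
  position \<open>w\<close> into \<open>w\<close> divided by its squared modulus and negates the
  height. Conjugating in the plane and negating the height again leaves \<open>inverse w\<close> at
  the original height.\<close>

definition half_turn :: "real^3^3" where
  "half_turn = vector [vector [1, 0, 0], vector [0, - 1, 0], vector [0, 0, - 1]]"

lemma half_turn_apply: "half_turn *v vector [a, b, c] = vector [a, - b, - c]"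
  by (simp add: half_turn_def Finite_Cartesian_Product.vec_eq_iff forall_3 matrix_vector_mult_def sum_3)

lemma rotation_matrix_half_turn: "rotation_matrix half_turn"
  unfolding rotation_matrix_def orthogonal_matrix
  by (simp add: half_turn_def det_3 Finite_Cartesian_Product.vec_eq_iff forall_3 matrix_matrix_mult_def
      sum_3 Finite_Cartesian_Product.transpose_def Finite_Cartesian_Product.mat_def)

lemma ambient_diffeomorphism_lift_inversion:
  assumes "compact K" "p \<notin> proj ` K"
  obtains f where "ambient_diffeomorphism f" "\<And>x. x \<in> K \<Longrightarrow> f x = lift (\<lambda>z. inverse (z - p)) x"
proof -
  \<comment> \<open>Moves the vertical line over \<open>p\<close>, which the link avoids, to the
    axis of the twist.\<close>
  let ?t = "\<lambda>x. x + space_point (- p, 0)"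
  have pt: "proj (?t x) = proj x - p" "?t x $ 3 = x $ 3" for x
    using linear_add[OF bounded_linear.linear[OF bounded_linear_proj]] by simp_all
  have "compact (?t ` K)"
    using assms(1) by (intro compact_continuous_image continuous_intros)
  moreover have "\<not> (y$1 = 0 \<and> y$2 = 0)" if y: "y \<in> ?t ` K" for y
  proof
    assume "y$1 = 0 \<and> y$2 = 0"
    then have "proj y = 0" by (simp add: proj_def complex_eq_iff)
    with y pt(1) assms(2) show False by (auto simp: image_iff)
  qed
  ultimately obtain g where g: "ambient_diffeomorphism g"
    "\<And>y. y \<in> ?t ` K \<Longrightarrow> g y = vector [y$1 / ((y$1)\<^sup>2 + (y$2)\<^sup>2), y$2 / ((y$1)\<^sup>2 + (y$2)\<^sup>2), - y$3]"
    using ambient_diffeomorphism_inversion[of "?t ` K"] by blast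
  have "ambient_diffeomorphism ((*v) half_turn \<circ> (g \<circ> ?t))"
    by (intro ambient_diffeomorphism_compose ambient_diffeomorphism_translation g(1)
        ambient_diffeomorphism_rotation rotation_matrix_half_turn)
  moreover have "((*v) half_turn \<circ> (g \<circ> ?t)) x = lift (\<lambda>z. inverse (z - p)) x" if "x \<in> K" for x
  proof (rule real3_eqI)
    have "g (?t x) = vector [?t x$1 / ((?t x$1)\<^sup>2 + (?t x$2)\<^sup>2),
        ?t x$2 / ((?t x$1)\<^sup>2 + (?t x$2)\<^sup>2), - ?t x$3]"
      using that by (intro g(2) imageI)
    then have gx: "((*v) half_turn \<circ> (g \<circ> ?t)) x = vector [?t x$1 / ((?t x$1)\<^sup>2 + (?t x$2)\<^sup>2),
        - (?t x$2 / ((?t x$1)\<^sup>2 + (?t x$2)\<^sup>2)), ?t x$3]"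
      by (simp only: comp_def half_turn_apply minus_minus)
    have coords: "y $ 1 = Re (proj y)" "y $ 2 = Im (proj y)" for y
      by (simp_all add: proj_def)
    have inv: "Complex (Re w / ((Re w)\<^sup>2 + (Im w)\<^sup>2)) (- (Im w / ((Re w)\<^sup>2 + (Im w)\<^sup>2))) = inverse w"
      for w by (simp add: complex_eq_iff)
    have "proj (((*v) half_turn \<circ> (g \<circ> ?t)) x) = inverse (proj (?t x))"
      unfolding gx inv[of "proj (?t x)", symmetric] coords[symmetric] by (simp only: proj_def vector_3)
    then show "proj (((*v) half_turn \<circ> (g \<circ> ?t)) x) = proj (lift (\<lambda>z. inverse (z - p)) x)"
      by (simp only: pt(1) proj_lift)
    show "((*v) half_turn \<circ> (g \<circ> ?t)) x $ 3 = lift (\<lambda>z. inverse (z - p)) x $ 3"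
      unfolding gx using pt(2) by simp
  qed
  ultimately show thesis by (rule that)
qed

text \<open>Serves both shades at once: the shade of the chosen \<open>R0\<close> becomes the shade
  of the new unbounded region.\<close>

lemma change_unbounded_region:
  assumes "K \<in> link_type L" "is_diagram D K" "is_shading D \<sigma>" "R0 \<in> regions D"
  shows "\<exists>K' D' \<sigma>'. K' \<in> link_type L \<and> is_diagram D' K' \<and> is_shading D' \<sigma>' \<and>
    adjusted_goeritz D' \<sigma>' = adjusted_goeritz D \<sigma> \<and>
    (\<exists>R\<in>regions D'. \<not> bounded R \<and> (R \<in> \<sigma>' \<longleftrightarrow> R0 \<in> \<sigma>))"
proof -
  obtain Q where Q: "rotation_matrix Q" "regular_projection ((*v) Q ` K)" "D = diagram_of ((*v) Q ` K)"
    using assms(2) unfolding is_diagram_def by blast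
  \<comment> \<open>Rotating the link first makes the projection vertical. A rotation is an ambient
    diffeomorphism, so the link type is kept.\<close>
  define K1 where "K1 = (*v) Q ` K"
  have K1: "K1 \<in> link_type L" "regular_projection K1" "D = diagram_of K1"
    using link_type_image[OF assms(1) ambient_diffeomorphism_rotation[OF Q(1)]] Q by (simp_all add: K1_def)
  have U: "compact (universe D)" using compact_universe[OF K1(2)] K1(3) by simp
  have R0: "R0 \<in> components (- universe D)" using assms(4) by (simp add: regions_def)
  have oR0: "open R0" "R0 \<noteq> {}" "R0 \<subseteq> - universe D"
    using open_components[OF open_Compl[OF compact_imp_closed[OF U]] R0]
      in_components_nonempty[OF R0] in_components_subset[OF R0] by auto
  then obtain p where p: "p \<in> R0" "p \<notin> universe D" by blast
  let ?m = "\<lambda>z. inverse (z - p)"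
  interpret punctured_conformal ?m "\<lambda>w. inverse w + p" p 0
    by (rule punctured_conformal_inversion)
  have "compact K1" using K1(2) link_compact unfolding regular_projection_def by blast
  moreover have "p \<notin> proj ` K1" using p(2) K1(3) by (simp add: diagram_of_def)
  ultimately obtain f where f: "ambient_diffeomorphism f" "\<And>x. x \<in> K1 \<Longrightarrow> f x = lift ?m x"
    using ambient_diffeomorphism_lift_inversion by blast
  define K2 where "K2 = lift ?m ` K1"
  have "f ` K1 = K2" unfolding K2_def using f(2) by simp
  then have K2: "K2 \<in> link_type L" using link_type_image[OF K1(1) f(1)] by simp
  have "regular_projection K2"
    unfolding K2_def using regular_projection_lift[OF K1(2) _ smooth_on_inversion f] p(2) K1(3) by simp
  \<comment> \<open>\<open>K2\<close> is already in position for the vertical projection, so the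
    identity is the rotation that \<open>is_diagram\<close> asks for.\<close>
  moreover have "(*v) (Finite_Cartesian_Product.mat 1) ` K2 = K2" by simp
  moreover have "rotation_matrix (Finite_Cartesian_Product.mat 1 :: real^3^3)"
    by (simp add: rotation_matrix_def orthogonal_matrix_id)
  ultimately have dia: "is_diagram (diagram_of K2) K2"
    unfolding is_diagram_def by metis
  have \<sigma>: "\<sigma> \<subseteq> regions D" using assms(3) by (simp add: is_shading_def)
  note tr = transfer_shading[of K1, folded K2_def K1(3), OF U p(2)]
  have "transfer R0 \<in> transfer ` \<sigma> \<longleftrightarrow> R0 \<in> \<sigma>"
    using inj_on_image_mem_iff[OF tr(2) assms(4) \<sigma>] .
  then have "\<exists>R\<in>regions (diagram_of K2). \<not> bounded R \<and> (R \<in> transfer ` \<sigma> \<longleftrightarrow> R0 \<in> \<sigma>)"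
    using transfer_unbounded[OF oR0(1) p(1)] tr(1) assms(4) by blast
  with K2 dia tr(3)[OF assms(3)] adjusted_goeritz_lift[of K1, folded K2_def K1(3), OF U p(2) \<sigma>]
  show ?thesis by blast
qed

theorem proposition5:
  fixes L :: "(real^3) set"
  assumes "is_link L"
  shows "adj_goeritz_set (link_type L) = adj_goeritz_set_s (link_type L) \<and>
         adj_goeritz_set_s (link_type L) = adj_goeritz_set_u (link_type L)"
proof -
  have regular: "\<exists>K'. regular_projection K' \<and> D = diagram_of K'" if "is_diagram D K" for D K
    using that unfolding is_diagram_def by blast
  \<comment> \<open>An edge has a shaded region on one side and an unshaded one on the other, so it
    provides a region of either shade to send to infinity.\<close>
  have both: "(\<exists>R. R \<in> \<sigma>) \<and> (\<exists>R. R \<in> regions D - \<sigma>)" if "is_diagram D K" "is_shading D \<sigma>" for D \<sigma> K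
  proof -
    have "edges D \<noteq> {}" using regular[OF that(1)] edges_nonempty by auto
    then show ?thesis using that(2) unfolding is_shading_def by blast
  qed
  \<comment> \<open>The shading is transported, not exchanged: one of its own shaded regions becomes
    unbounded. This covers uniformly the case in which the unbounded region was shaded from the
    start.\<close>
  have s: "adj_goeritz_set (link_type L) \<subseteq> adj_goeritz_set_s (link_type L)"
  proof
    fix G assume "G \<in> adj_goeritz_set (link_type L)"
    then obtain D \<sigma> K where D: "G = adjusted_goeritz D \<sigma>" "K \<in> link_type L" "is_diagram D K" "is_shading D \<sigma>"
      unfolding adj_goeritz_set_def by blast
    obtain R0 where R0: "R0 \<in> \<sigma>" "R0 \<in> regions D" using both[OF D(3,4)] D(4) unfolding is_shading_def by blast
    from change_unbounded_region[OF D(2-4) R0(2)] R0(1) D(1)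
    show "G \<in> adj_goeritz_set_s (link_type L)"
      unfolding adj_goeritz_set_s_def is_sigma_s_def by blast
  qed
  have u: "adj_goeritz_set (link_type L) \<subseteq> adj_goeritz_set_u (link_type L)"
  proof
    fix G assume "G \<in> adj_goeritz_set (link_type L)"
    then obtain D \<sigma> K where D: "G = adjusted_goeritz D \<sigma>" "K \<in> link_type L" "is_diagram D K" "is_shading D \<sigma>"
      unfolding adj_goeritz_set_def by blast
    obtain R0 where R0: "R0 \<notin> \<sigma>" "R0 \<in> regions D" using both[OF D(3,4)] by blast
    from change_unbounded_region[OF D(2-4) R0(2)] R0(1) D(1)
    show "G \<in> adj_goeritz_set_u (link_type L)"
      unfolding adj_goeritz_set_u_def is_sigma_u_def by blast
  qed
  have "adj_goeritz_set_s (link_type L) \<subseteq> adj_goeritz_set (link_type L)"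
    "adj_goeritz_set_u (link_type L) \<subseteq> adj_goeritz_set (link_type L)"
    unfolding adj_goeritz_set_def adj_goeritz_set_s_def adj_goeritz_set_u_def
      is_sigma_s_def is_sigma_u_def by blast+
  with s u show ?thesis by blast
qed

end
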